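(* Let $\mathcal{A}$ be a finite nonempty set and let $d \in \mathbb{N}$, $d \geq 1$. For each $n \geq 1$, let $\mathcal{E}_n$ be the event that $X_\omega = \varnothing$, where $\omega$ is drawn according to $\mathbb{P}_{n,\alpha}$. Then for each $\alpha \in [0,1]$, $$\lim_{n\to\infty} \mathbb{P}_{n,\alpha}(\mathcal{E}_n) = \begin{cases} \zeta_X(\alpha)^{-1}, & \text{if } \alpha \in [0, |\mathcal{A}|^{-1}),\\ 0, & \text{if } \alpha \in [|\mathcal{A}|^{-1}, 1].\end{cases}$$ Furthermore, for $\alpha \neq |\mathcal{A}|^{-1}$, the rate of convergence to this limit is at least exponential in $n$; that is, there exist $C>0$, $\beta\in(0,1)$ and $n_0$ (depending on $\mathcal{A}$, $d$, $\alpha$) such that for all $n \ge n_0$ the absolute difference between $\mathbb{P}_{n,\alpha}(\mathcal{E}_n)$ and its limit is at most $C\beta^n$.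
   Context: Let $F_n = [1,n]^d \subset \mathbb{Z}^d$ (integer points). Let $\Omega_n$ be the power set of $\mathcal{A}^{F_n}$. For $\alpha\in[0,1]$, $\mathbb{P}_{n,\alpha}$ is the probability measure on $\Omega_n$ under which the random subset $\omega \subset \mathcal{A}^{F_n}$ includes each element of $\mathcal{A}^{F_n}$ independently with probability $\alpha$. For $\omega \subset \mathcal{A}^{F_n}$, $$X_\omega = \{x \in \mathcal{A}^{\mathbb{Z}^d} : \forall p \in \mathbb{Z}^d,\ x|_{F_n+p} \in \omega\},$$ where patterns are identified up to translation. The shift action $\sigma$ of $\mathbb{Z}^d$ on $\mathcal{A}^{\mathbb{Z}^d}$ is $(\sigma^p(x))_q = x_{p+q}$. A finite orbit in $\mathcal{A}^{\mathbb{Z}^d}$ is a nonempty finite set $\gamma\subset \mathcal{A}^{\mathbb{Z}^d}$ such that $\{\sigma^p(x): p \in \mathbb{Z}^d\} = \gamma$ for every $x\in\gamma$; $|\gamma|$ is its cardinality. With $X = \mathcal{A}^{\mathbb{Z}^d}$ and $\{\gamma_i\}_i$ an enumeration of all the finite orbits in $X$ (listed so that $|\gamma_i|\le|\gamma_j|$ for $i<j$), define $$\zeta_X(t) = \prod_i \bigl(1 - t^{|\gamma_i|}\bigr)^{-1}.$$ This has radius of convergence $|\mathcal{A}|^{-1}$. *)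

theory Defs
  imports "HOL-Analysis.Analysis" "HOL-Probability.Probability"
begin

text \<open>
  The lattice of dimension \<open>CARD('d)\<close> is \<open>int ^ 'd\<close>, and the alphabet is the finite type \<open>'a\<close>.
  Types are nonempty, so \<open>CARD('d) \<ge> 1\<close> and \<open>CARD('a) \<ge> 1\<close>.
\<close>

type_synonym ('a, 'd) config = "int ^ 'd \<Rightarrow> 'a"

definition shift :: "int ^ 'd::finite \<Rightarrow> ('a, 'd) config \<Rightarrow> ('a, 'd) config" where
  "shift p x = (\<lambda>q. x (p + q))"

definition cube :: "nat \<Rightarrow> (int ^ 'd::finite) set" where
  "cube n = {p. \<forall>i. 1 \<le> p $ i \<and> p $ i \<le> int n}"

text \<open>Patterns on the cube are represented by functions that are \<open>undefined\<close> outside it.\<close>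

definition patterns :: "nat \<Rightarrow> ('a, 'd::finite) config set" where
  "patterns n = (cube n \<rightarrow>\<^sub>E UNIV)"

text \<open>
  Identifying patterns up to translation, the restriction of \<open>x\<close> to \<open>cube n + p\<close> becomes
  the pattern \<open>q \<mapsto> x (p + q)\<close> on \<open>cube n\<close>.
\<close>

definition subshift :: "nat \<Rightarrow> ('a, 'd::finite) config set \<Rightarrow> ('a, 'd) config set" where
  "subshift n \<omega> = {x. \<forall>p. restrict (shift p x) (cube n) \<in> \<omega>}"

definition random_patterns :: "nat \<Rightarrow> real \<Rightarrow> ('a::finite, 'd::finite) config set pmf" where
  "random_patterns n \<alpha> =
     map_pmf (\<lambda>b. {u \<in> patterns n. b u}) (Pi_pmf (patterns n) False (\<lambda>_. bernoulli_pmf \<alpha>))"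

definition emptiness_event :: "nat \<Rightarrow> ('a, 'd::finite) config set set" where
  "emptiness_event n = {\<omega> \<in> Pow (patterns n). subshift n \<omega> = {}}"

definition finite_orbit :: "('a, 'd::finite) config set \<Rightarrow> bool" where
  "finite_orbit \<gamma> \<longleftrightarrow> \<gamma> \<noteq> {} \<and> finite \<gamma> \<and> (\<forall>x\<in>\<gamma>. range (\<lambda>p. shift p x) = \<gamma>)"

definition finite_orbits :: "('a, 'd::finite) config set \<Rightarrow> ('a, 'd) config set set" where
  "finite_orbits X = {\<gamma>. \<gamma> \<subseteq> X \<and> finite_orbit \<gamma>}"

text \<open>
  The index set of an enumeration is an initial segment of the naturals: there may be only
  finitely many finite orbits (the full shift has exactly one if \<open>CARD('a) = 1\<close>).
\<close>

definition orbit_indices :: "('a, 'd::finite) config set \<Rightarrow> nat set" where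
  "orbit_indices X =
     (if finite (finite_orbits X) then {..<card (finite_orbits X)} else UNIV)"

definition is_orbit_enumeration ::
    "('a, 'd::finite) config set \<Rightarrow> (nat \<Rightarrow> ('a, 'd) config set) \<Rightarrow> bool" where
  "is_orbit_enumeration X \<gamma> \<longleftrightarrow>
     bij_betw \<gamma> (orbit_indices X) (finite_orbits X) \<and>
     mono_on (orbit_indices X) (\<lambda>i. card (\<gamma> i))"

text \<open>Such an enumeration exists over a finite alphabet; see \<open>orbit_enumeration\<close> below.\<close>

definition orbit_enumeration :: "('a, 'd::finite) config set \<Rightarrow> nat \<Rightarrow> ('a, 'd) config set" where
  "orbit_enumeration X = (SOME \<gamma>. is_orbit_enumeration X \<gamma>)"

definition zeta :: "('a, 'd::finite) config set \<Rightarrow> real \<Rightarrow> real" where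
  "zeta X t =
     (\<Prod>i. if i \<in> orbit_indices X then inverse (1 - t ^ card (orbit_enumeration X i)) else 1)"

lemma shift_add: "shift p (shift q x) = shift (p + q) x"
  by (simp add: shift_def fun_eq_iff algebra_simps)

lemma shift_0 [simp]: "shift 0 x = x"
  by (simp add: shift_def)

lemma finite_orbit_fact_period:
  assumes \<gamma>: "finite_orbit \<gamma>" and x: "x \<in> \<gamma>"
  shows "shift (int (fact (card \<gamma>)) *s p) x = x"
proof -
  let ?f = "\<lambda>j::nat. shift (int j *s p) x"
  have fin: "finite \<gamma>" and orb: "range (\<lambda>p. shift p x) = \<gamma>"
    using \<gamma> x unfolding finite_orbit_def by auto
  have "?f ` {..card \<gamma>} \<subseteq> \<gamma>" using orb by auto
  then have "card (?f ` {..card \<gamma>}) \<le> card \<gamma>" using fin card_mono by blast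
  then have "\<not> inj_on ?f {..card \<gamma>}" using card_image by fastforce
  then obtain a b where ab: "a < b" "b \<le> card \<gamma>" "?f a = ?f b"
    unfolding inj_on_def by (metis atMost_iff linorder_neqE_nat)
  define m where "m = b - a"
  have m: "1 \<le> m" "m \<le> card \<gamma>" using ab by (auto simp: m_def)
  have "int b *s p = int a *s p + int m *s p"
    using ab by (simp add: m_def vec_eq_iff of_nat_diff algebra_simps)
  then have "shift (- (int a *s p)) (?f b) = shift (int m *s p) x"
    by (simp add: shift_add)
  moreover have "shift (- (int a *s p)) (?f a) = x"
    by (simp add: shift_add)
  ultimately have per: "shift (int m *s p) x = x" using ab by simp
  have mult: "shift (int (k * m) *s p) x = x" for k
  proof (induction k)
    case 0
    have "int (0 * m) *s p = 0" by (simp add: vec_eq_iff)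
    then show ?case by (metis shift_0)
  next
    case (Suc k)
    have "int (Suc k * m) *s p = int (k * m) *s p + int m *s p"
      by (simp add: vec_eq_iff algebra_simps)
    then show ?case using per Suc by (metis shift_add)
  qed
  have "m dvd fact (card \<gamma>)" using m by (rule dvd_fact)
  then obtain k where "fact (card \<gamma>) = k * m" by (metis dvd_def mult.commute)
  then show ?thesis using mult by metis
qed

lemma finite_finite_orbits_card:
  fixes X :: "('a::finite, 'd::finite) config set"
  shows "finite {\<gamma> \<in> finite_orbits X. card \<gamma> = k}"
proof -
  define M where "M = int (fact k)"
  have M: "M > 0" by (simp add: M_def)
  define B :: "(int ^ 'd) set" where "B = {p. \<forall>i. p $ i \<in> {0..<M}}"
  define P :: "('a, 'd) config set" where "P = {x. \<forall>p. shift (M *s p) x = x}"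
  have "finite B"
  proof -
    have "B \<subseteq> vec_lambda ` (UNIV \<rightarrow>\<^sub>E {0..<M})"
    proof
      fix p assume "p \<in> B"
      then have "p = vec_lambda (vec_nth p)" "vec_nth p \<in> UNIV \<rightarrow>\<^sub>E {0..<M}"
        by (auto simp: B_def)
      then show "p \<in> vec_lambda ` (UNIV \<rightarrow>\<^sub>E {0..<M})" by blast
    qed
    then show ?thesis by (rule finite_subset) (intro finite_imageI finite_PiE; simp)
  qed
  have val: "x q = x (\<chi> i. (q $ i) mod M)" if "x \<in> P" for x q
  proof -
    have "q = M *s (\<chi> i. (q $ i) div M) + (\<chi> i. (q $ i) mod M)"
      by (simp add: vec_eq_iff)
    moreover have "shift (M *s (\<chi> i. (q $ i) div M)) x (\<chi> i. (q $ i) mod M)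
        = x (\<chi> i. (q $ i) mod M)"
      using that by (simp add: P_def)
    ultimately show ?thesis by (simp add: shift_def)
  qed
  have "inj_on (\<lambda>x. restrict x B) P"
  proof (rule inj_onI)
    fix x y assume "x \<in> P" "y \<in> P" and eq: "restrict x B = restrict y B"
    have "x q = y q" for q
    proof -
      have "(\<chi> i. (q $ i) mod M) \<in> B" using M by (simp add: B_def)
      then have "x (\<chi> i. (q $ i) mod M) = y (\<chi> i. (q $ i) mod M)"
        using eq by (metis restrict_apply')
      then show ?thesis using val[OF \<open>x \<in> P\<close>] val[OF \<open>y \<in> P\<close>] by metis
    qed
    then show "x = y" by blast
  qed
  moreover have "finite ((\<lambda>x. restrict x B) ` P)"
    by (rule finite_subset[OF _ finite_PiE[OF \<open>finite B\<close>, of "\<lambda>_. UNIV :: 'a set"]]) auto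
  ultimately have "finite P" using finite_image_iff by blast
  moreover have "{\<gamma> \<in> finite_orbits X. card \<gamma> = k} \<subseteq> Pow P"
    using finite_orbit_fact_period by (auto simp: finite_orbits_def P_def M_def)
  ultimately show ?thesis by (meson finite_Pow_iff finite_subset)
qed

lemma ex_orbit_enumeration:
  fixes X :: "('a::finite, 'd::finite) config set"
  shows "\<exists>\<gamma>. is_orbit_enumeration X \<gamma>"
proof -
  define L where "L = (\<lambda>k. {\<gamma> \<in> finite_orbits X. card \<gamma> = k})"
  have "\<forall>k. \<exists>e. bij_betw e (L k) {0..<card (L k)}"
    using finite_finite_orbits_card ex_bij_betw_finite_nat unfolding L_def by blast
  then obtain e where e: "\<And>k. bij_betw (e k) (L k) {0..<card (L k)}" by metis
  define h where "h = (\<lambda>\<gamma>. (\<Sum>j<card \<gamma>. card (L j)) + e (card \<gamma>) \<gamma>)"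
  have ub: "h \<gamma> < (\<Sum>j<Suc (card \<gamma>). card (L j))" if "\<gamma> \<in> finite_orbits X" for \<gamma>
  proof -
    have "\<gamma> \<in> L (card \<gamma>)" using that by (simp add: L_def)
    then have "e (card \<gamma>) \<gamma> < card (L (card \<gamma>))"
      using e[of "card \<gamma>"] by (auto simp: bij_betw_def)
    then show ?thesis by (simp add: h_def)
  qed
  have lt: "h \<gamma> < h \<delta>" if "\<gamma> \<in> finite_orbits X" "card \<gamma> < card \<delta>" for \<gamma> \<delta>
  proof -
    have "(\<Sum>j<Suc (card \<gamma>). card (L j)) \<le> (\<Sum>j<card \<delta>. card (L j))"
      using that by (intro sum_mono2) auto
    then show ?thesis using ub[OF that(1)] by (simp add: h_def)
  qed
  have inj: "inj_on h (finite_orbits X)"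
  proof (rule inj_onI)
    fix \<gamma> \<delta> assume g: "\<gamma> \<in> finite_orbits X" "\<delta> \<in> finite_orbits X" and eq: "h \<gamma> = h \<delta>"
    have c: "card \<gamma> = card \<delta>"
      using lt[OF g(1), of \<delta>] lt[OF g(2), of \<gamma>] eq by (metis less_irrefl linorder_neqE_nat)
    then have "e (card \<delta>) \<gamma> = e (card \<delta>) \<delta>" using eq by (simp add: h_def)
    moreover have "\<gamma> \<in> L (card \<delta>)" "\<delta> \<in> L (card \<delta>)" using g c by (auto simp: L_def)
    ultimately show "\<gamma> = \<delta>" using e[of "card \<delta>"] by (auto simp: bij_betw_def inj_on_def)
  qed
  define S where "S = h ` finite_orbits X"
  have bij: "bij_betw (the_inv_into (finite_orbits X) h) S (finite_orbits X)"
    unfolding S_def using inj by (intro bij_betw_the_inv_into) (simp add: bij_betw_def)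
  have hinv: "h (the_inv_into (finite_orbits X) h s) = s" if "s \<in> S" for s
    using that inj unfolding S_def by (rule_tac f_the_inv_into_f) auto
  have fin: "finite S \<longleftrightarrow> finite (finite_orbits X)" "card S = card (finite_orbits X)"
    unfolding S_def using inj by (auto simp: finite_image_iff card_image)
  have "\<exists>r. bij_betw r (orbit_indices X) S \<and> strict_mono_on (orbit_indices X) r"
  proof (cases "finite S")
    case True
    then obtain r where "bij_betw r {..<card S} S" "strict_mono_on {..<card S} r"
      using ex_bij_betw_strict_mono_card by (metis lessThan_atLeast0)
    then show ?thesis using fin True by (auto simp: orbit_indices_def)
  next
    case False
    then have "bij_betw (enumerate S) UNIV S" "strict_mono (enumerate S)"
      by (auto simp: bij_enumerate strict_mono_enumerate)
    then show ?thesis using fin False by (auto simp: orbit_indices_def)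
  qed
  then obtain r where r: "bij_betw r (orbit_indices X) S" "strict_mono_on (orbit_indices X) r"
    by blast
  have "bij_betw (the_inv_into (finite_orbits X) h \<circ> r) (orbit_indices X) (finite_orbits X)"
    using r(1) bij by (rule bij_betw_trans)
  moreover have "mono_on (orbit_indices X) (\<lambda>i. card ((the_inv_into (finite_orbits X) h \<circ> r) i))"
  proof (rule mono_onI)
    fix i j assume ij: "i \<in> orbit_indices X" "j \<in> orbit_indices X" "i \<le> j"
    let ?g = "the_inv_into (finite_orbits X) h \<circ> r"
    have rS: "r i \<in> S" "r j \<in> S" using r(1) ij by (auto simp: bij_betw_def)
    have "r i \<le> r j" using r(2) ij by (metis strict_mono_on_leD)
    then have "h (?g i) \<le> h (?g j)" using hinv rS by simp
    moreover have "?g j \<in> finite_orbits X" using bij rS by (auto simp: bij_betw_def)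
    ultimately show "card (?g i) \<le> card (?g j)" using lt by (meson not_le)
  qed
  ultimately show ?thesis unfolding is_orbit_enumeration_def by blast
qed

lemma orbit_enumeration:
  fixes X :: "('a::finite, 'd::finite) config set"
  shows "is_orbit_enumeration X (orbit_enumeration X)"
  unfolding orbit_enumeration_def by (rule someI_ex[OF ex_orbit_enumeration])

end

(*
  If omega contains all windows (patterns on cube n) of a finite orbit, then X_omega is nonempty.
  By a Morse--Hedlund argument, the windows of the orbits of size at most n/2 are pairwise distinct,
  so the probability that omega contains no such orbit is exactly the finite product of the factors
  1 - alpha^|gamma|. It bounds the probability of emptiness from above, and it tends to
  1/zeta(alpha) exponentially fast for alpha < 1/|A|; for alpha >= 1/|A| it tends to 0.

  Conversely, let x be a point of X_omega and look at its windows at the positions of a box of side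
  m = 2 K (n div 2). If there are at most n/2 distinct ones, then x is locally periodic and the windows
  contain those of a small finite orbit. Otherwise there are j > n/2 distinct ones, and it suffices to
  show that at most (lambda |A|)^j patterns on the box have j distinct windows, with lambda close to 1:
  the expected number of those contained in omega is then exponentially small. Such a pattern is
  described by links between repeated windows, o(j) of which suffice, and by the letters lying in
  no linked window; all windows containing such a letter are first occurrences, and therefore these
  letters number at most (1 + 1/K)^d j. The same count bounds the number of orbits of size k
  by (lambda |A|)^k.
*)
theory Submission
  imports Defs "HOL-Real_Asymp.Real_Asymp"
begin

section \<open>Windows and the Morse--Hedlund argument\<close>

text \<open>The obstacle is the ratio between repetitions and distinct windows: a box holds about
  n^d window positions while j may be as small as n/2, so naming a source for every repeated window,
  at about log n bits each, would cost far more than |A|^j. Only a family of repeated windows that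
  still covers all their letters is linked. In blocks of side n/2, extremal positions form such a
  family: those near the block ends in all coordinates number about L^d, and every other one is
  followed by L first occurrences, of which there are at most j. With L near n^(1/(2d)) the total is
  of order j * n^(-1/(2d)), so the links cost less than any \<eta>^j with \<eta> > 1. The side near
  K * n comes from the extreme case of pairwise distinct windows: (m + n - 1)^d letters against m^d
  windows is a ratio close to (1 + 1/K)^d. The strict inequality \<alpha> < 1/|A| pays for this
  ratio and for \<eta>. The bound n/2 on small orbits comes from pairs: two such orbits have
  together at most n windows, the limit of the Morse--Hedlund argument.\<close>

definition window :: "nat \<Rightarrow> ('a, 'd::finite) config \<Rightarrow> int ^ 'd \<Rightarrow> ('a, 'd) config" where
  "window n x p = restrict (shift p x) (cube n)"

text \<open>Positions start at 0 and \<open>cube\<close> at 1, so that the letters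
  \<open>p + c\<close> with \<open>p\<close> in \<open>grid m\<close> and \<open>c\<close> in
  \<open>cube n\<close> lie in \<open>cube (m + n - 1)\<close>.\<close>

definition grid :: "nat \<Rightarrow> (int ^ 'd::finite) set" where
  "grid m = {p. \<forall>i. 0 \<le> p $ i \<and> p $ i < int m}"

lemma shift_apply: "shift p x q = x (p + q)"
  by (simp add: shift_def)

lemma restrict_eq_iff: "restrict f A = restrict g A \<longleftrightarrow> (\<forall>a\<in>A. f a = g a)"
  by (auto simp: restrict_def fun_eq_iff)

lemma window_eq_iff: "window n x p = window n y q \<longleftrightarrow> (\<forall>c\<in>cube n. x (p + c) = y (q + c))"
  by (simp add: window_def restrict_eq_iff shift_apply)

lemma window_in_patterns: "window n x p \<in> patterns n"
  by (simp add: window_def patterns_def)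

lemma subshift_window: "subshift n \<omega> = {x. \<forall>p. window n x p \<in> \<omega>}"
  by (simp add: subshift_def window_def)

lemma bij_betw_vec_nth_PiE:
  "bij_betw vec_nth {p :: 'b ^ 'd::finite. \<forall>i. p $ i \<in> A i} (\<Pi>\<^sub>E i\<in>UNIV. A i)"
proof (rule bij_betwI[where g = vec_lambda])
qed (auto simp: PiE_def)

lemma finite_vec_set:
  assumes "\<And>i. finite (A i)"
  shows "finite {p :: 'b ^ 'd::finite. \<forall>i. p $ i \<in> A i}"
  using bij_betw_finite[OF bij_betw_vec_nth_PiE] assms by (metis finite_PiE finite)

lemma card_vec_set:
  "card {p :: 'b ^ 'd::finite. \<forall>i. p $ i \<in> A i} = (\<Prod>i\<in>UNIV. card (A i))"
  using bij_betw_same_card[OF bij_betw_vec_nth_PiE] by (metis card_PiE finite)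

lemma grid_alt: "grid m = {p. \<forall>i. p $ i \<in> {0..<int m}}"
  and cube_alt: "cube n = {p. \<forall>i. p $ i \<in> {1..int n}}"
  by (auto simp: grid_def cube_def)

lemma finite_grid: "finite (grid m)" and finite_cube: "finite (cube n)"
  unfolding grid_alt cube_alt by (rule finite_vec_set; simp)+

lemma card_grid: "card (grid m :: (int ^ 'd::finite) set) = m ^ CARD('d)"
  unfolding grid_alt card_vec_set by simp

lemma finite_patterns: "finite (patterns n :: ('a::finite, 'd::finite) config set)"
  unfolding patterns_def by (intro finite_PiE finite_cube) simp

lemma cube_mono: "k \<le> n \<Longrightarrow> (cube k :: (int ^ 'd::finite) set) \<subseteq> cube n"
  by (auto simp: cube_def intro: order_trans)

lemma one_in_cube: "(\<chi> i. 1) \<in> cube (Suc k)"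
  by (simp add: cube_def)

text \<open>A deterministic extension rule: iterated along the axes, it propagates an agreement of
  two configurations through an orthant.\<close>

definition determined_at :: "nat \<Rightarrow> ('a, 'd::finite) config set \<Rightarrow> bool" where
  "determined_at k S \<longleftrightarrow>
     (\<forall>y\<in>S. \<forall>z\<in>S. (\<forall>c\<in>cube k. y c = z c) \<longrightarrow> (\<forall>c\<in>cube (Suc k). y c = z c))"

text \<open>The Morse--Hedlund argument: the number of restrictions to \<open>cube k\<close> cannot
  increase strictly with \<open>k\<close> for ever.\<close>

lemma morse_hedlund:
  fixes S :: "('a, 'd::finite) config set"
  assumes "finite S" "S \<noteq> {}" and card: "card ((\<lambda>y. restrict y (cube n)) ` S) \<le> n"
  shows "\<exists>k<n. determined_at k S"
proof (rule ccontr)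
  assume neg: "\<not> ?thesis"
  define p where "p = (\<lambda>k. (\<lambda>y. restrict y (cube k)) ` S)"
    have step: "card (p k) < card (p (Suc k))" if "k < n" for k
    proof (rule ccontr)
      assume le: "\<not> ?thesis"
      let ?r = "\<lambda>f. restrict f (cube k)"
      have img: "p k = ?r ` p (Suc k)"
        unfolding p_def image_image using inf_absorb2[OF cube_mono[of k "Suc k", where 'd = 'd]] by simp
      have fin: "finite (p (Suc k))" using assms by (simp add: p_def)
      have "card (?r ` p (Suc k)) = card (p (Suc k))"
        using le img card_image_le[OF fin, of ?r] by simp
      then have inj: "inj_on ?r (p (Suc k))" using fin eq_card_imp_inj_on by blast
      have "\<forall>c\<in>cube (Suc k). y c = z c" if "y \<in> S" "z \<in> S" "\<forall>c\<in>cube k. y c = z c" for y z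
      proof -
        have "?r (restrict y (cube (Suc k))) = ?r (restrict z (cube (Suc k)))"
          unfolding restrict_restrict inf_absorb2[OF cube_mono[OF le_SucI[OF order_refl]]]
          using that by (simp add: restrict_eq_iff)
        then have "restrict y (cube (Suc k)) = restrict z (cube (Suc k))"
          by (rule inj_onD[OF inj]) (use that in \<open>simp_all add: p_def\<close>)
        then show ?thesis by (simp add: restrict_eq_iff)
      qed
      then show False using neg \<open>k < n\<close> unfolding determined_at_def by blast
    qed
    \<comment> \<open>The count starts at 1, because \<open>cube 0\<close> is empty and
      \<open>S\<close> is not; n strict increases then push it above n.\<close>
    have "k \<le> n \<Longrightarrow> k < card (p k)" for k
    proof (induction k)
      case 0
      then show ?case using assms by (simp add: p_def card_gt_0_iff)
    next
      case (Suc k)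
      then show ?case using step[of k] by simp
    qed
    then show False using card by (metis p_def le_refl not_less)
qed

text \<open>A \<open>k\<close>-cube moved one step along an axis stays inside the
  \<open>Suc k\<close>-cube around its old place, so agreement spreads by induction on the
  coordinate sum. Membership in \<open>S\<close> is asked only for shifts below \<open>v\<close>,
  because \<open>S\<close> may consist of the shifts by a finite box.\<close>

lemma determined_orthant:
  fixes S :: "('a, 'd::finite) config set"
  assumes det: "determined_at k S"
    and agree: "\<forall>c\<in>cube k. y c = z c"
    and v: "\<forall>i. 0 \<le> v $ i"
    and S: "\<And>w. \<forall>i. 0 \<le> w $ i \<and> w $ i \<le> v $ i \<Longrightarrow> shift w y \<in> S \<and> shift w z \<in> S"
  shows "\<forall>c\<in>cube (Suc k). y (v + c) = z (v + c)"
  using v S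
proof (induction "nat (\<Sum>i\<in>UNIV. v $ i)" arbitrary: v rule: less_induct)
  case less
  have in_S: "shift v y \<in> S" "shift v z \<in> S" using less.prems by auto
  have "\<forall>c\<in>cube k. shift v y c = shift v z c"
  proof (cases "v = 0")
    case True
    then show ?thesis using agree by simp
  next
    case False
    then obtain i where i: "v $ i > 0"
      using less.prems(1) by (metis order_le_less vec_eq_iff zero_index)
    define w where "w = v - axis i 1"
    have wi: "w $ j = v $ j - (if j = i then 1 else 0)" for j
      by (simp add: w_def axis_def)
    have "(\<Sum>j\<in>UNIV. w $ j) < (\<Sum>j\<in>UNIV. v $ j)"
      by (rule sum_strict_mono_ex1) (auto simp: wi intro!: exI[of _ i])
    moreover have "0 \<le> (\<Sum>j\<in>UNIV. w $ j)"
      by (rule sum_nonneg) (use i less.prems in \<open>auto simp: wi\<close>)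
    ultimately have lt: "nat (\<Sum>j\<in>UNIV. w $ j) < nat (\<Sum>j\<in>UNIV. v $ j)" by simp
    have w0: "\<forall>j. 0 \<le> w $ j" using i less.prems(1) by (auto simp: wi)
    have "shift u y \<in> S \<and> shift u z \<in> S" if "\<forall>j. 0 \<le> u $ j \<and> u $ j \<le> w $ j" for u
      using that by (intro less.prems(2)) (smt (verit) wi)
    from less.hyps[OF lt w0 this] have IH: "\<forall>c\<in>cube (Suc k). y (w + c) = z (w + c)" .
    show ?thesis
    proof
      fix c :: "int ^ 'd" assume "c \<in> cube k"
      then have "axis i 1 + c \<in> cube (Suc k)"
        unfolding cube_def by (auto simp: axis_def) (smt (verit))+
      then have "y (w + (axis i 1 + c)) = z (w + (axis i 1 + c))" using IH by blast
      then show "shift v y c = shift v z c" by (simp add: shift_apply w_def)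
    qed
  qed
  from det in_S this have "\<forall>c\<in>cube (Suc k). shift v y c = shift v z c"
    unfolding determined_at_def by blast
  then show ?case by (simp add: shift_apply)
qed

section \<open>Finite orbits are identified by their windows\<close>

text \<open>The extension rule gives agreement on the positive orthant, and the common period
  \<open>M\<close> carries every position into that orthant.\<close>

lemma restrict_cube_inj_on:
  fixes Y :: "('a, 'd::finite) config set"
  assumes fin: "finite Y" and inv: "\<And>y p. y \<in> Y \<Longrightarrow> shift p y \<in> Y"
    and M: "M > 0" "\<And>y p. y \<in> Y \<Longrightarrow> shift (int M *s p) y = y"
    and card: "card ((\<lambda>y. restrict y (cube n)) ` Y) \<le> n"
  shows "inj_on (\<lambda>y. restrict y (cube n)) Y"
proof (rule inj_onI)
  fix y z assume y: "y \<in> Y" and z: "z \<in> Y" and "restrict y (cube n) = restrict z (cube n)"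
  then have agree: "\<forall>c\<in>cube n. y c = z c" by (simp add: restrict_eq_iff)
  have "Y \<noteq> {}" using y by blast
  obtain k where k: "k < n" "determined_at k Y"
    using morse_hedlund[OF fin \<open>Y \<noteq> {}\<close> card] by blast
  have "\<forall>c\<in>cube k. y c = z c" using agree cube_mono[of k n, where 'd = 'd] k by auto
  note D = determined_orthant[OF k(2) this]
  show "y = z"
  proof
    fix q :: "int ^ 'd"
    define B where "B = Max (insert 0 (range (\<lambda>i. \<bar>q $ i\<bar>)))"
    have B: "\<bar>q $ i\<bar> \<le> B" for i unfolding B_def by (rule Max_ge) auto
    \<comment> \<open>The multiple of the period outweighs the negative coordinates of
      \<open>q\<close>; the all-ones vector is subtracted because it is the corner of the cube at
      which the two points are compared.\<close>
    define v where "v = int M *s (\<chi> i. B + 1) + q - (\<chi> i. 1)"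
    have "0 \<le> v $ i" for i
    proof -
      have "B + 1 \<le> int M * (B + 1)" using M(1) B[of i] mult_right_mono[of 1 "int M" "B + 1"] by simp
      then show ?thesis using B[of i] by (simp add: v_def)
    qed
    then have "y (v + (\<chi> i. 1)) = z (v + (\<chi> i. 1))"
      using D[of v] inv y z one_in_cube by blast
    moreover have "v + (\<chi> i. 1) = int M *s (\<chi> i. B + 1) + q" by (simp add: v_def)
    ultimately show "y q = z q"
      using fun_cong[OF M(2)[OF y], of "\<chi> i. B + 1" q] fun_cong[OF M(2)[OF z], of "\<chi> i. B + 1" q]
      by (simp add: shift_apply)
  qed
qed

lemma finite_orbit_shift: "finite_orbit \<gamma> \<Longrightarrow> y \<in> \<gamma> \<Longrightarrow> shift p y \<in> \<gamma>"
  unfolding finite_orbit_def by blast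

text \<open>The product of the two factorials is a period of both orbits. With \<gamma> = \<delta>
  this treats a single orbit; for two different orbits it separates their windows.\<close>

lemma finite_orbit_union_inj:
  assumes o: "finite_orbit \<gamma>" "finite_orbit \<delta>"
    and card: "card ((\<lambda>y. restrict y (cube n)) ` (\<gamma> \<union> \<delta>)) \<le> n"
  shows "inj_on (\<lambda>y. restrict y (cube n)) (\<gamma> \<union> \<delta>)"
proof -
  have per: "shift (int (fact (card \<gamma>) * fact (card \<delta>)) *s p) y = y" if "y \<in> \<gamma> \<union> \<delta>" for y p
  proof -
    have "int (fact (card \<gamma>) * fact (card \<delta>)) *s p = int (fact (card \<gamma>)) *s (int (fact (card \<delta>)) *s p)"
      "int (fact (card \<gamma>) * fact (card \<delta>)) *s p = int (fact (card \<delta>)) *s (int (fact (card \<gamma>)) *s p)"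
      by (simp_all add: vec_eq_iff)
    then show ?thesis
      using that finite_orbit_fact_period o by (metis Un_iff)
  qed
  have fin: "finite (\<gamma> \<union> \<delta>)" using o by (auto simp: finite_orbit_def)
  have inv: "\<And>y p. y \<in> \<gamma> \<union> \<delta> \<Longrightarrow> shift p y \<in> \<gamma> \<union> \<delta>" using finite_orbit_shift o by blast
  show ?thesis
    by (rule restrict_cube_inj_on[OF fin inv _ per card]) auto
qed

section \<open>Few windows force a finite orbit\<close>

lemma finite_orbit_range:
  fixes y :: "('a, 'd::finite) config"
  assumes "finite (range (\<lambda>p. shift p y))"
  shows "finite_orbit (range (\<lambda>p. shift p y))"
  unfolding finite_orbit_def
proof (intro conjI ballI assms)
  fix z assume "z \<in> range (\<lambda>p. shift p y)"
  then obtain r where z: "z = shift r y" by blast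
  have "shift p y = shift (p - r) z" "shift p z = shift (p + r) y" for p
    by (simp_all add: z shift_add)
  then show "range (\<lambda>p. shift p z) = range (\<lambda>p. shift p y)"
    by (metis (no_types, lifting) image_subset_iff rangeI subset_antisym)
qed simp

lemma card_window_image_mono:
  assumes "k \<le> n" "finite P"
  shows "card (window k x ` P) \<le> card (window n x ` P)"
proof -
  have "window k x p = restrict (window n x p) (cube k)" for p
    unfolding window_def restrict_restrict inf_absorb2[OF cube_mono[OF assms(1)]] ..
  then have "window k x ` P = (\<lambda>f. restrict f (cube k)) ` window n x ` P"
    by (simp add: image_image)
  then show ?thesis using card_image_le assms(2) by (metis finite_imageI)
qed

text \<open>Subtracting \<open>t i\<close> from a coordinate that is at least \<open>t i\<close>
  descends to the residues without leaving the box, so periodicity inside the box suffices.\<close>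

lemma mod_periodic:
  fixes x :: "('a, 'd::finite) config" and t :: "'d \<Rightarrow> int"
  assumes t: "\<And>i. 0 < t i"
    and per: "\<And>i q. \<forall>j. 0 \<le> q $ j \<and> q $ j + (if j = i then t i else 0) < u j \<Longrightarrow>
      x (q + axis i (t i)) = x q"
    and q: "\<forall>j. 0 \<le> q $ j \<and> q $ j < u j"
  shows "x q = x (\<chi> i. q $ i mod t i)"
  using q
proof (induction "nat (\<Sum>i\<in>UNIV. q $ i)" arbitrary: q rule: less_induct)
  case less
  show ?case
  proof (cases "\<forall>i. q $ i < t i")
    case True
    then have "(\<chi> i. q $ i mod t i) = q" using less.prems by (simp add: vec_eq_iff)
    then show ?thesis by simp
  next
    case False
    then obtain i where i: "t i \<le> q $ i" by (meson not_le)
    define w where "w = q - axis i (t i)"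
    have wi: "w $ j = q $ j - (if j = i then t i else 0)" for j
      by (simp add: w_def axis_def)
    have w0: "\<forall>j. 0 \<le> w $ j \<and> w $ j + (if j = i then t i else 0) < u j"
      using i less.prems by (auto simp: wi)
    then have w1: "\<forall>j. 0 \<le> w $ j \<and> w $ j < u j"
      using t[of i] by (smt (verit))
    have "(\<Sum>j\<in>UNIV. w $ j) < (\<Sum>j\<in>UNIV. q $ j)"
      by (rule sum_strict_mono_ex1) (use t[of i] in \<open>auto simp: wi intro!: exI[of _ i]\<close>)
    moreover have "0 \<le> (\<Sum>j\<in>UNIV. w $ j)"
      by (rule sum_nonneg) (use w1 in auto)
    ultimately have "x w = x (\<chi> i. w $ i mod t i)"
      using less.hyps w1 by simp
    moreover have "(\<chi> i. w $ i mod t i) = (\<chi> i. q $ i mod t i)"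
      by (auto simp: vec_eq_iff wi)
    moreover have "x q = x w" using per[OF w0] by (simp add: w_def)
    ultimately show ?thesis by simp
  qed
qed

text \<open>On each axis, the pigeonhole principle gives two equal \<open>k\<close>-windows among
  the positions 0 to J; the extension rule turns each coincidence into a period of \<open>x\<close>
  on a large part of the box. The periodic extension \<open>y\<close> of that part generates the
  orbit.\<close>

lemma few_windows_imp_finite_orbit:
  fixes x :: "('a, 'd::finite) config"
  assumes n: "0 < n" and m: "2 * n \<le> m" and J: "card (window n x ` grid m) \<le> n"
  shows "\<exists>\<gamma>. finite_orbit \<gamma> \<and> card \<gamma> \<le> card (window n x ` grid m)
    \<and> (\<lambda>y. restrict y (cube n)) ` \<gamma> \<subseteq> window n x ` grid m"
proof -
  define J where "J = card (window n x ` grid m)"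
  have Jn: "J \<le> n" using assms by (simp add: J_def)
  define S where "S = (\<lambda>p. shift p x) ` grid m"
  have S: "shift p x \<in> S" if "p \<in> grid m" for p using that by (simp add: S_def)
  have S_img: "(\<lambda>y. restrict y (cube n)) ` S = window n x ` grid m"
    by (simp add: S_def image_image window_def)
  have "0 \<in> (grid m :: (int ^ 'd) set)" using n m by (simp add: grid_def)
  then have "S \<noteq> {}" unfolding S_def by blast
  then obtain k where k: "k < n" "determined_at k S"
    using morse_hedlund[of S n] J finite_grid by (auto simp: S_img) (auto simp: S_def)
  have "\<exists>a b. a < b \<and> b \<le> J \<and> window k x (axis i (int a)) = window k x (axis i (int b))" for i
  proof -
    let ?f = "\<lambda>a::nat. window k x (axis i (int a))"
    have "axis i (int a) \<in> grid m" if "a \<le> J" for a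
      using that Jn n m by (simp add: grid_def axis_def)
    then have "?f ` {..J} \<subseteq> window k x ` grid m" by auto
    then have "card (?f ` {..J}) \<le> card (window k x ` grid m)"
      by (intro card_mono finite_imageI finite_grid)
    also have "\<dots> \<le> J" unfolding J_def
      by (intro card_window_image_mono finite_grid) (use k in simp)
    finally have "\<not> inj_on ?f {..J}" using card_image by fastforce
    then show ?thesis
      unfolding inj_on_def by (metis atMost_iff linorder_neqE_nat)
  qed
  then obtain a b where ab: "\<And>i. a i < b i" "\<And>i. b i \<le> J"
    "\<And>i. window k x (axis i (int (a i))) = window k x (axis i (int (b i)))"
    by metis
  define t where "t = (\<lambda>i. int (b i) - int (a i))"
  have t: "0 < t i" for i using ab(1)[of i] by (simp add: t_def)
  \<comment> \<open>The \<open>+ 1\<close> points to the first letter of a window, since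
    \<open>cube\<close> starts at 1.\<close>
  define A :: "int ^ 'd" where "A = (\<chi> i. int (a i) + 1)"
  have per: "x (A + (q + axis i (t i))) = x (A + q)"
    if q: "\<forall>j. 0 \<le> q $ j \<and> q $ j + (if j = i then t i else 0) < int m - int (a j)" for i q
  proof -
    \<comment> \<open>Chosen so that position \<open>v + 1\<close> of the two shifted configurations
      is \<open>A + q\<close> and \<open>A + q + axis i (t i)\<close>.\<close>
    define v where "v = A + q - (\<chi> i. 1) - axis i (int (a i))"
    have v: "v $ j = int (a j) + q $ j - (if j = i then int (a j) else 0)" for j
      by (simp add: v_def A_def axis_def)
    have v0: "\<forall>j. 0 \<le> v $ j" using q by (auto simp: v)
    have agree: "\<forall>c\<in>cube k. shift (axis i (int (a i))) x c = shift (axis i (int (b i))) x c"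
      using ab(3)[of i] by (simp add: window_eq_iff shift_apply)
    have mem: "axis i (int (a i)) + w \<in> grid m \<and> axis i (int (b i)) + w \<in> grid m"
      if w: "\<forall>j. 0 \<le> w $ j \<and> w $ j \<le> v $ j" for w
    proof -
      have *: "0 \<le> w $ j + (if j = i then int (a j) else 0) \<and>
            w $ j + (if j = i then int (a j) else 0) < int m \<and>
            0 \<le> w $ j + (if j = i then int (b j) else 0) \<and>
            w $ j + (if j = i then int (b j) else 0) < int m" for j
        using w[rule_format, of j] q[rule_format, of j] ab(1)[of i]
        by (cases "j = i") (auto simp: v t_def)
      have "(axis i u + w) $ j = w $ j + (if j = i then u else 0)" for u j
        by (simp add: axis_def)
      moreover have "(if j = i then int (a i) else 0) = (if j = i then int (a j) else 0)"
        "(if j = i then int (b i) else 0) = (if j = i then int (b j) else 0)" for j by auto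
      ultimately show ?thesis using * by (simp only: grid_def mem_Collect_eq) blast
    qed
    have "shift w (shift (axis i (int (a i))) x) \<in> S \<and> shift w (shift (axis i (int (b i))) x) \<in> S"
      if w: "\<forall>j. 0 \<le> w $ j \<and> w $ j \<le> v $ j" for w
      using mem[OF w] S by (simp add: shift_add add.commute)
    from determined_orthant[OF k(2) agree v0 this] one_in_cube
    have "shift (axis i (int (a i))) x (v + (\<chi> i. 1)) = shift (axis i (int (b i))) x (v + (\<chi> i. 1))"
      by blast
    moreover have "axis i (int (a i)) + (v + (\<chi> i. 1)) = A + q"
      by (simp add: v_def)
    moreover have "axis i (int (b i)) + (v + (\<chi> i. 1)) = A + (q + axis i (t i))"
      by (simp add: vec_eq_iff v_def t_def axis_def)
    ultimately show ?thesis by (simp add: shift_apply)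
  qed
  define y where "y = (\<lambda>q. x (A + (\<chi> i. q $ i mod t i)))"
  have xy: "x (A + q) = y q" if "\<forall>j. 0 \<le> q $ j \<and> q $ j < int m - int (a j)" for q
    using mod_periodic[OF t, where x = "\<lambda>q. x (A + q)", OF per that] by (simp add: y_def)
  have y_mod: "shift p y = shift (\<chi> i. p $ i mod t i) y" for p
    by (simp add: shift_def y_def fun_eq_iff mod_simps)
  \<comment> \<open>Every window of \<open>y\<close> already starts in the first period. It ends
    inside the periodic part of \<open>x\<close>: its coordinates stay below
    \<open>b j - a j + n\<close>, which is at most \<open>m - a j\<close> because
    \<open>b j \<le> n\<close> and \<open>2 * n \<le> m\<close>.\<close>
  have win: "restrict (shift p y) (cube n) \<in> window n x ` grid m" for p
  proof -
    define p0 where "p0 = (\<chi> i. p $ i mod t i)"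
    have p0: "0 \<le> p0 $ i" "p0 $ i < t i" for i using t[of i] by (simp_all add: p0_def)
    have "shift p y c = shift (A + p0) x c" if c: "c \<in> cube n" for c
    proof -
      have "0 \<le> (p0 + c) $ j \<and> (p0 + c) $ j < int m - int (a j)" for j
      proof -
        have "1 \<le> c $ j" "c $ j \<le> int n" using c by (simp_all add: cube_def)
        then show ?thesis
          using p0[of j] ab(2)[of j] Jn m unfolding t_def vector_add_component by linarith
      qed
      then have "x (A + (p0 + c)) = y (p0 + c)" by (intro xy) blast
      then show ?thesis by (simp add: y_mod[of p] p0_def[symmetric] shift_apply add.assoc)
    qed
    then have "restrict (shift p y) (cube n) = window n x (A + p0)"
      by (simp add: window_def restrict_eq_iff)
    moreover have "A + p0 \<in> grid m"
    proof -
      have "0 \<le> (A + p0) $ j \<and> (A + p0) $ j < int m" for j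
        using p0[of j] ab(2)[of j] Jn n m unfolding t_def A_def by auto
      then show ?thesis by (simp add: grid_def)
    qed
    ultimately show ?thesis by blast
  qed
  define \<gamma> where "\<gamma> = range (\<lambda>p. shift p y)"
  have "\<gamma> \<subseteq> (\<lambda>p. shift p y) ` {p. \<forall>i. p $ i \<in> {0..<t i}}"
  proof
    fix z assume "z \<in> \<gamma>"
    then obtain p where "z = shift (\<chi> i. p $ i mod t i) y" using y_mod by (auto simp: \<gamma>_def)
    moreover have "(\<chi> i. p $ i mod t i) \<in> {p. \<forall>i. p $ i \<in> {0..<t i}}" using t by simp
    ultimately show "z \<in> (\<lambda>p. shift p y) ` {p. \<forall>i. p $ i \<in> {0..<t i}}" by blast
  qed
  then have "finite \<gamma>" by (rule finite_subset) (intro finite_imageI finite_vec_set; simp)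
  then have orb: "finite_orbit \<gamma>" unfolding \<gamma>_def by (rule finite_orbit_range)
  have sub: "(\<lambda>z. restrict z (cube n)) ` \<gamma> \<subseteq> window n x ` grid m"
    using win by (auto simp: \<gamma>_def)
  then have cJ: "card ((\<lambda>z. restrict z (cube n)) ` \<gamma>) \<le> J"
    unfolding J_def by (intro card_mono finite_imageI finite_grid)
  \<comment> \<open>Different points of the orbit show different windows, so the window count also
    bounds the size of the orbit.\<close>
  then have "inj_on (\<lambda>z. restrict z (cube n)) \<gamma>"
    using finite_orbit_union_inj[OF orb orb, of n] Jn by simp
  then have "card \<gamma> \<le> J" using cJ card_image by metis
  then show ?thesis using orb sub J_def by blast
qed

section \<open>Counting patterns with few distinct windows\<close>

text \<open>A mixed-radix system: each new weight exceeds every value that the previous terms can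
  reach, so the terms cannot cancel.\<close>

lemma ex_separating_weights:
  fixes M :: int
  assumes "0 \<le> M"
  shows "\<exists>w :: 'd::finite \<Rightarrow> int. (\<forall>i. 0 \<le> w i) \<and>
    (\<forall>\<delta>. (\<forall>i. \<bar>\<delta> i\<bar> \<le> M) \<longrightarrow> (\<Sum>i\<in>UNIV. w i * \<delta> i) = 0 \<longrightarrow> (\<forall>i. \<delta> i = 0))"
proof -
  have "\<exists>w :: 'd \<Rightarrow> int. (\<forall>i. 0 \<le> w i) \<and>
    (\<forall>\<delta>. (\<forall>i. \<bar>\<delta> i\<bar> \<le> M) \<longrightarrow> (\<Sum>i\<in>I. w i * \<delta> i) = 0 \<longrightarrow> (\<forall>i\<in>I. \<delta> i = 0))"
    if "finite I" for I
    using that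
  proof (induction I)
    case empty
    show ?case by (auto intro: exI[of _ "\<lambda>_. 0"])
  next
    case (insert k I)
    then obtain w where w: "\<And>i. 0 \<le> w i"
      "\<And>\<delta>. (\<forall>i. \<bar>\<delta> i\<bar> \<le> M) \<Longrightarrow> (\<Sum>i\<in>I. w i * \<delta> i) = 0 \<Longrightarrow> \<forall>i\<in>I. \<delta> i = 0"
      by metis
    define b where "b = 1 + (\<Sum>i\<in>I. w i * M)"
    have b: "0 < b" unfolding b_def using w(1) assms by (simp add: add_pos_nonneg sum_nonneg)
    have "\<forall>i\<in>insert k I. \<delta> i = 0"
      if \<delta>: "\<forall>i. \<bar>\<delta> i\<bar> \<le> M" and "(\<Sum>i\<in>insert k I. (w(k := b)) i * \<delta> i) = 0" for \<delta>
    proof -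
      have "(\<Sum>i\<in>I. (w(k := b)) i * \<delta> i) = (\<Sum>i\<in>I. w i * \<delta> i)"
        using insert.hyps by (intro sum.cong) auto
      then have eq: "b * \<delta> k + (\<Sum>i\<in>I. w i * \<delta> i) = 0" using that insert.hyps by simp
      have "\<bar>\<Sum>i\<in>I. w i * \<delta> i\<bar> \<le> (\<Sum>i\<in>I. \<bar>w i * \<delta> i\<bar>)" by (rule sum_abs)
      also have "\<dots> \<le> (\<Sum>i\<in>I. w i * M)"
        by (intro sum_mono) (use w(1) \<delta> in \<open>auto simp: abs_mult intro!: mult_left_mono\<close>)
      finally have "\<bar>b * \<delta> k\<bar> < b * 1" using eq by (simp add: b_def)
      then have "\<delta> k = 0" using b by (simp add: abs_mult)
      then show ?thesis using w(2)[OF \<delta>] eq by simp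
    qed
    moreover have "\<forall>i. 0 \<le> (w(k := b)) i" using w(1) b by simp
    ultimately show ?case by (intro exI[of _ "w(k := b)"]) blast
  qed
  from this[of UNIV] show ?thesis by simp
qed

text \<open>Such a subset is listed by a \<open>T\<close>-tuple padded with \<open>None\<close>, the
  extra symbol behind the \<open>+ 1\<close>.\<close>

lemma card_small_subsets_le:
  assumes "finite S"
  shows "card {G. G \<subseteq> S \<and> card G \<le> T} \<le> (card S + 1) ^ T"
proof -
  let ?F = "{..<T} \<rightarrow>\<^sub>E insert None (Some ` S)"
  have fin: "finite ?F" using assms by (intro finite_PiE) auto
  have "{G. G \<subseteq> S \<and> card G \<le> T} \<subseteq> (\<lambda>f. {x. Some x \<in> f ` {..<T}}) ` ?F"
  proof
    fix G assume "G \<in> {G. G \<subseteq> S \<and> card G \<le> T}"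
    then have G: "G \<subseteq> S" "card G \<le> T" by auto
    then obtain h where h: "bij_betw h {0..<card G} G"
      using ex_bij_betw_nat_finite assms finite_subset by metis
    define f where "f = restrict (\<lambda>i. if i < card G then Some (h i) else None) {..<T}"
    have hG: "h ` {0..<card G} = G" using h by (simp add: bij_betw_def)
    have "f \<in> ?F"
      unfolding f_def restrict_PiE_iff using hG G(1) by (auto 0 3)
    moreover have "G = {x. Some x \<in> f ` {..<T}}"
    proof -
      have "Some x \<in> f ` {..<T} \<longleftrightarrow> x \<in> h ` {0..<card G}" for x
      proof
        assume "Some x \<in> f ` {..<T}"
        then obtain i where "i < T" "f i = Some x" by (auto simp: image_iff)
        then show "x \<in> h ` {0..<card G}" by (auto simp: f_def split: if_splits)
      next
        assume "x \<in> h ` {0..<card G}"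
        then obtain i where "i < card G" "x = h i" by auto
        then have "i < T" "f i = Some x" using G(2) by (auto simp: f_def)
        then show "Some x \<in> f ` {..<T}" by (metis imageI lessThan_iff)
      qed
      then show ?thesis using hG by auto
    qed
    ultimately show "G \<in> (\<lambda>f. {x. Some x \<in> f ` {..<T}}) ` ?F" by blast
  qed
  then have "card {G. G \<subseteq> S \<and> card G \<le> T} \<le> card ?F"
    using fin by (meson card_image_le card_mono finite_imageI le_trans)
  also have "\<dots> = (card S + 1) ^ T"
    using assms by (simp add: card_PiE card_image)
  finally show ?thesis .
qed

text \<open>A shift by \<open>n - 1\<close> of all coordinates beyond a threshold maps letters injectively to windows
  containing them. Averaging over the thresholds shows that the letters lying in
  windows of \<open>R\<close> only are hardly more numerous than \<open>R\<close>.\<close>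

lemma card_letters_le:
  fixes U R :: "(int ^ 'd::finite) set"
  assumes U: "U \<subseteq> cube (m + n - 1)" and R: "finite R"
    and UR: "\<And>p c. p \<in> grid m \<Longrightarrow> c \<in> cube n \<Longrightarrow> p + c \<in> U \<Longrightarrow> p \<in> R"
    and n: "1 \<le> n" and K: "K * (n - 1) \<le> m"
  shows "card U * K ^ CARD('d) \<le> (K + 1) ^ CARD('d) * card R"
proof -
  define h where "h = int n - 1"
  have h: "0 \<le> h" using n by (simp add: h_def)
  have Kh: "int K * h \<le> int m" using K n by (metis h_def of_nat_1 of_nat_diff of_nat_le_iff of_nat_mult)
  \<comment> \<open>In each coordinate a slab of thickness \<open>h = n - 1\<close> behind the
    threshold is left out and \<open>f\<close> closes the gap, hence is injective on
    \<open>dom\<close>. Each coordinate of \<open>r - f \<tau> r\<close> is 1 or n, so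
    \<open>r\<close> is a corner of the window at \<open>f \<tau> r\<close>.\<close>
  define dom where "dom = (\<lambda>(\<tau> :: 'd \<Rightarrow> nat) (r :: int ^ 'd).
    \<forall>i. \<not> (int (\<tau> i) * h \<le> r $ i - 1 \<and> r $ i - 1 < int (\<tau> i) * h + h))"
  define f where "f = (\<lambda>(\<tau> :: 'd \<Rightarrow> nat) (r :: int ^ 'd).
    \<chi> i. if r $ i - 1 < int (\<tau> i) * h then r $ i - 1 else r $ i - 1 - h)"
  define \<T> where "\<T> = (UNIV :: 'd set) \<rightarrow>\<^sub>E {0..K}"
  have finT: "finite \<T>" unfolding \<T>_def by (intro finite_PiE) auto
  have finU: "finite U" using U finite_cube finite_subset by blast
  have le_R: "card {r \<in> U. dom \<tau> r} \<le> card R" if \<tau>: "\<tau> \<in> \<T>" for \<tau>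
  proof (rule card_inj_on_le[where f = "f \<tau>"])
    show "inj_on (f \<tau>) {r \<in> U. dom \<tau> r}"
    proof (rule inj_onI)
      fix r r' assume r: "r \<in> {r \<in> U. dom \<tau> r}" "r' \<in> {r \<in> U. dom \<tau> r}" and eq: "f \<tau> r = f \<tau> r'"
      have "r $ i = r' $ i" for i
      proof -
        have "f \<tau> r $ i = f \<tau> r' $ i" using eq by simp
        moreover have "\<not> (int (\<tau> i) * h \<le> r $ i - 1 \<and> r $ i - 1 < int (\<tau> i) * h + h)"
          "\<not> (int (\<tau> i) * h \<le> r' $ i - 1 \<and> r' $ i - 1 < int (\<tau> i) * h + h)"
          using r by (auto simp: dom_def)
        ultimately show ?thesis by (auto simp: f_def split: if_splits)
      qed
      then show "r = r'" by (simp add: vec_eq_iff)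
    qed
    show "f \<tau> ` {r \<in> U. dom \<tau> r} \<subseteq> R"
    proof
      fix p assume "p \<in> f \<tau> ` {r \<in> U. dom \<tau> r}"
      then obtain r where r: "r \<in> U" "dom \<tau> r" "p = f \<tau> r" by blast
      have *: "0 \<le> p $ i \<and> p $ i < int m \<and> 1 \<le> (r - p) $ i \<and> (r - p) $ i \<le> int n" for i
      proof -
        have "int (\<tau> i) * h \<le> int K * h"
          using \<tau> h by (intro mult_right_mono) (auto simp: \<T>_def PiE_def Pi_def)
        then have "int (\<tau> i) * h \<le> int m" "0 \<le> int (\<tau> i) * h" using Kh h by auto
        moreover have "1 \<le> r $ i" "r $ i \<le> int (m + n - 1)" using r(1) U by (auto simp: cube_def)
        then have "1 \<le> r $ i" "r $ i \<le> int m + h" using n by (auto simp: h_def)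
        moreover have "\<not> (int (\<tau> i) * h \<le> r $ i - 1 \<and> r $ i - 1 < int (\<tau> i) * h + h)"
          using r(2) by (auto simp: dom_def)
        moreover have "int n = h + 1" by (simp add: h_def)
        moreover have "p $ i = (if r $ i - 1 < int (\<tau> i) * h then r $ i - 1 else r $ i - 1 - h)"
          by (simp add: r(3) f_def)
        ultimately show ?thesis using h
          unfolding vector_minus_component by (smt (verit))
      qed
      have "p \<in> grid m" "r - p \<in> cube n" using * by (simp_all add: grid_def cube_def)
      then show "p \<in> R" using UR[of p "r - p"] r(1) by simp
    qed
  qed (rule R)
  \<comment> \<open>The slabs of different thresholds are disjoint, so in each coordinate a letter
    is excluded by at most one of the \<open>K + 1\<close> thresholds.\<close>
  have ge_K: "K ^ CARD('d) \<le> card {\<tau> \<in> \<T>. dom \<tau> r}" for r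
  proof -
    define B where "B = (\<lambda>i. {0..K} - {nat ((r $ i - 1) div h)})"
    have "dom \<tau> r" if \<tau>: "\<tau> \<in> PiE UNIV B" for \<tau>
      unfolding dom_def
    proof (intro allI notI)
      fix i assume a: "int (\<tau> i) * h \<le> r $ i - 1 \<and> r $ i - 1 < int (\<tau> i) * h + h"
      then have hpos: "0 < h" by linarith
      have "(r $ i - 1) div h = int (\<tau> i)"
        using a hpos by (intro int_div_pos_eq[where r = "r $ i - 1 - int (\<tau> i) * h"]) (auto simp: algebra_simps)
      moreover have "\<tau> i \<noteq> nat ((r $ i - 1) div h)" using \<tau> by (auto simp: B_def PiE_def Pi_def)
      ultimately show False by simp
    qed
    moreover have "PiE UNIV B \<subseteq> \<T>" unfolding \<T>_def B_def by (intro PiE_mono) auto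
    ultimately have "PiE UNIV B \<subseteq> {\<tau> \<in> \<T>. dom \<tau> r}" by blast
    then have "card (PiE UNIV B) \<le> card {\<tau> \<in> \<T>. dom \<tau> r}"
      using finT by (intro card_mono) auto
    moreover have "K \<le> card (B i)" for i
      unfolding B_def by (subst card_Diff_singleton_if) auto
    then have "(\<Prod>i\<in>(UNIV :: 'd set). K) \<le> (\<Prod>i\<in>UNIV. card (B i))"
      by (intro prod_mono) auto
    then have "K ^ CARD('d) \<le> card (PiE UNIV B)" by (simp add: card_PiE)
    ultimately show ?thesis by linarith
  qed
  \<comment> \<open>Double counting of the pairs of a threshold vector and a letter in its
    domain.\<close>
  have "card U * K ^ CARD('d) \<le> (\<Sum>r\<in>U. card {\<tau> \<in> \<T>. dom \<tau> r})"
    using sum_mono[of U "\<lambda>_. K ^ CARD('d)"] ge_K by simp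
  also have "\<dots> = (\<Sum>r\<in>U. \<Sum>\<tau>\<in>\<T>. if dom \<tau> r then 1 else 0)"
    using finT by (simp add: sum.If_cases Int_def)
  also have "\<dots> = (\<Sum>\<tau>\<in>\<T>. \<Sum>r\<in>U. if dom \<tau> r then 1 else 0)" by (rule sum.swap)
  also have "\<dots> = (\<Sum>\<tau>\<in>\<T>. card {r \<in> U. dom \<tau> r})"
    using finU by (simp add: sum.If_cases Int_def)
  also have "\<dots> \<le> (\<Sum>\<tau>\<in>\<T>. card R)" by (intro sum_mono le_R)
  also have "\<dots> = (K + 1) ^ CARD('d) * card R" by (simp add: \<T>_def card_PiE)
  finally show ?thesis .
qed

lemma int_div_eq_imp_abs_less:
  fixes a b s :: int
  assumes "a div s = b div s" "0 < s"
  shows "\<bar>a - b\<bar> < s"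
proof -
  have "a - b = a mod s - b mod s"
    using assms(1) by (simp flip: minus_div_mult_eq_mod)
  moreover have "0 \<le> a mod s" "a mod s < s" "0 \<le> b mod s" "b mod s < s"
    using assms(2) by auto
  ultimately show ?thesis by linarith
qed

lemma int_div_less_iff:
  fixes x b s :: int
  assumes "0 < s"
  shows "x div s < b \<longleftrightarrow> x < b * s"
proof
  assume "x div s < b"
  then have "(x div s) * s \<le> (b - 1) * s" using assms by (intro mult_right_mono) auto
  moreover have "x = (x div s) * s + x mod s" "x mod s < s" using assms by auto
  ultimately show "x < b * s" unfolding left_diff_distrib by linarith
next
  assume "x < b * s"
  moreover have "x = (x div s) * s + x mod s" "0 \<le> x mod s" using assms by auto
  moreover have "b * s \<le> (x div s) * s" if "b \<le> x div s"
    using that assms by (intro mult_right_mono) auto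
  ultimately show "x div s < b" by linarith
qed

text \<open>Leaving the block within \<open>L\<close> steps forces the residue modulo
  \<open>s\<close> into an interval of \<open>L\<close> values: at the upper end for
  \<open>e = 1\<close>, at the lower end for \<open>e = -1\<close>.\<close>

lemma card_near_block_end_le:
  fixes s L :: nat and e :: int
  assumes s: "0 < s" and e: "e = 1 \<or> e = -1"
  shows "card {a \<in> {0..<int (b * s)}. (a + int L * e) div int s \<noteq> a div int s} \<le> b * L"
    (is "card ?A \<le> _")
proof -
  define D where "D = (if e = 1 then {int s - int L..<int s} else {0..<int L})"
  have "card ?A \<le> card ({0..<int b} \<times> D)"
  proof (rule card_inj_on_le[where f = "\<lambda>a. (a div int s, a mod int s)"])
    show "inj_on (\<lambda>a. (a div int s, a mod int s)) ?A"
      by (rule inj_onI) (metis Pair_inject div_mult_mod_eq)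
    show "(\<lambda>a. (a div int s, a mod int s)) ` ?A \<subseteq> {0..<int b} \<times> D"
    proof (rule image_subsetI)
      fix a assume "a \<in> ?A"
      then have a: "0 \<le> a" "a < int b * int s" "(a + int L * e) div int s \<noteq> a div int s" by auto
      define r where "r = a mod int s"
      have r: "0 \<le> r" "r < int s" using s by (simp_all add: r_def)
      have "a = a div int s * int s + r" by (simp add: r_def)
      then have "a + int L * e = (r + int L * e) + a div int s * int s" by simp
      then have "(a + int L * e) div int s = (r + int L * e) div int s + a div int s"
        using div_mult_self1[of "int s" "r + int L * e" "a div int s"] s
        by (simp only: add.commute of_nat_eq_0_iff)
      then have "(r + int L * e) div int s \<noteq> 0" using a(3) by simp
      then have "\<not> (0 \<le> r + int L * e \<and> r + int L * e < int s)"
        using div_pos_pos_trivial by blast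
      then have "r \<in> D" using r e by (auto simp: D_def)
      moreover have "a div int s < int b" using a s by (simp add: int_div_less_iff)
      ultimately show "(a div int s, a mod int s) \<in> {0..<int b} \<times> D"
        using a s by (simp add: r_def pos_imp_zdiv_nonneg_iff)
    qed
  qed (simp add: D_def)
  also have "\<dots> = b * L" by (simp add: D_def)
  finally show ?thesis .
qed

text \<open>The windows positioned in \<open>Q\<close> are covered by those at the positions that are maximal
  within their block, for one of the \<open>2 ^ d\<close> coordinatewise orders. Away from the ends
  of its block, a maximal position is followed by \<open>L\<close> positions outside \<open>Q\<close>.\<close>

lemma exists_small_cover:
  fixes Q :: "(int ^ 'd::finite) set"
  assumes Q: "Q \<subseteq> grid (b * s)" and s: "0 < s" "2 * s \<le> n"
  shows "\<exists>P\<subseteq>Q. (\<forall>p\<in>Q. \<forall>c\<in>cube n. \<exists>p'\<in>P. \<exists>c'\<in>cube n. p + c = p' + c') \<and>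
    L * card P \<le> 2 ^ CARD('d) * (L * (b * L) ^ CARD('d) + CARD('d) * card (grid (b * s) - Q))"
proof -
  define m where "m = b * s"
  have finQ: "finite Q" using Q finite_grid finite_subset by blast
  define sg where "sg = (\<lambda>(S :: 'd set) i. if i \<in> S then 1 else -1 :: int)"
  define le where "le = (\<lambda>(S :: 'd set) (p :: int ^ 'd) q. \<forall>i. sg S i * p $ i \<le> sg S i * q $ i)"
  define block where "block = (\<lambda>p q :: int ^ 'd. \<forall>i. p $ i div int s = q $ i div int s)"
  define M where "M = (\<lambda>S. {p \<in> Q. \<forall>q\<in>Q. block p q \<longrightarrow> le S p q \<longrightarrow> q = p})"
  define P where "P = (\<Union>S. M S)"
  have "\<exists>p'\<in>P. \<exists>c'\<in>cube n. p + c = p' + c'" if p: "p \<in> Q" and c: "c \<in> cube n" for p c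
  proof -
    \<comment> \<open>The order is adapted to the place of the letter in its window: where
      \<open>c $ i > s\<close> the window can move up by less than \<open>s\<close> and still
      contain the letter, elsewhere it can move down, as \<open>2 * s \<le> n\<close>.\<close>
    define S where "S = {i. int s < c $ i}"
    define X where "X = {q \<in> Q. block p q \<and> le S p q}"
    \<comment> \<open>\<open>f\<close> is strictly increasing for \<open>le S\<close>, so a
      maximiser of \<open>f\<close> over \<open>X\<close> is maximal in its block.\<close>
    define f where "f = (\<lambda>q :: int ^ 'd. \<Sum>i\<in>UNIV. sg S i * q $ i)"
    have X: "finite X" "p \<in> X" using finQ p by (auto simp: X_def block_def le_def)
    then have "Max (f ` X) \<in> f ` X" by (intro Max_in) auto
    then obtain q where q: "q \<in> X" "f q = Max (f ` X)" by auto
    have fmax: "f q' \<le> f q" if "q' \<in> X" for q' using q X that by simp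
    have "q \<in> M S"
      unfolding M_def
    proof (intro CollectI conjI ballI impI)
      show "q \<in> Q" using q by (simp add: X_def)
      fix q' assume q': "q' \<in> Q" "block q q'" "le S q q'"
      then have "q' \<in> X" using q(1) unfolding X_def block_def le_def
        by (auto intro: order_trans)
      then have "f q' \<le> f q" by (rule fmax)
      have "q $ i = q' $ i" for i
      proof (rule ccontr)
        assume "q $ i \<noteq> q' $ i"
        then have "sg S i * q $ i \<noteq> sg S i * q' $ i" by (simp add: sg_def)
        then have "sg S i * q $ i < sg S i * q' $ i" using q'(3) by (simp add: le_def order.not_eq_order_implies_strict)
        then have "f q < f q'" unfolding f_def
          by (intro sum_strict_mono_ex1) (use q'(3) in \<open>auto simp: le_def\<close>)
        then show False using \<open>f q' \<le> f q\<close> by simp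
      qed
      then show "q' = q" by (simp add: vec_eq_iff)
    qed
    moreover have "p + c - q \<in> cube n"
    proof -
      have "1 \<le> (p + c - q) $ i \<and> (p + c - q) $ i \<le> int n" for i
      proof -
        have b: "\<bar>p $ i - q $ i\<bar> < int s"
          using q(1) s by (intro int_div_eq_imp_abs_less) (auto simp: X_def block_def)
        have l: "sg S i * p $ i \<le> sg S i * q $ i" using q(1) by (auto simp: X_def le_def)
        have ci: "1 \<le> c $ i" "c $ i \<le> int n" using c by (auto simp: cube_def)
        have n: "2 * int s \<le> int n" using s(2) by linarith
        show ?thesis
        proof (cases "int s < c $ i")
          case True
          then have "p $ i \<le> q $ i" using l by (simp add: sg_def S_def)
          then show ?thesis using b ci n True by simp
        next
          case False
          then have "q $ i \<le> p $ i" using l by (simp add: sg_def S_def)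
          then show ?thesis using b ci n False by simp
        qed
      qed
      then show ?thesis by (simp add: cube_def)
    qed
    ultimately show ?thesis
      unfolding P_def by (intro bexI[of _ q] bexI[of _ "p + c - q"]) auto
  qed
  moreover have "L * card P \<le> 2 ^ CARD('d) * (L * (b * L) ^ CARD('d) + CARD('d) * card (grid m - Q))"
  proof -
    have "L * card (M S) \<le> L * (b * L) ^ CARD('d) + CARD('d) * card (grid m - Q)" for S
    proof -
      \<comment> \<open>\<open>near\<close> holds the positions close to the block end in all
        coordinates at once; a position in \<open>far i\<close> still has \<open>L\<close> steps
        inside its block in direction \<open>i\<close>.\<close>
      define near where "near = {p :: int ^ 'd. \<forall>i. p $ i \<in>
        {a \<in> {0..<int (b * s)}. (a + int L * sg S i) div int s \<noteq> a div int s}}"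
      define far where "far = (\<lambda>i. {p \<in> M S. (p $ i + int L * sg S i) div int s = p $ i div int s})"
      have near_fin: "finite near" unfolding near_def
        by (intro finite_vec_set, rule finite_subset[of _ "{0..<int (b * s)}"]) auto
      have MQ: "M S \<subseteq> Q" by (auto simp: M_def)
      have finM: "finite (M S)" using MQ finQ finite_subset by blast
      have near_card: "card near \<le> (b * L) ^ CARD('d)"
      proof -
        have "card near = (\<Prod>i\<in>UNIV. card {a \<in> {0..<int (b * s)}. (a + int L * sg S i) div int s \<noteq> a div int s})"
          unfolding near_def by (rule card_vec_set)
        also have "\<dots> \<le> (\<Prod>i\<in>(UNIV :: 'd set). b * L)"
          by (intro prod_mono conjI card_near_block_end_le) (auto simp: s sg_def)
        finally show ?thesis by simp
      qed
      \<comment> \<open>Maximality puts the \<open>L\<close> positions following a point of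
        \<open>far i\<close> outside \<open>Q\<close>. Runs of two different points are disjoint: if
        they met, one point would lie on the run of the other, in the same block and above
        it.\<close>
      have far_card: "L * card (far i) \<le> card (grid m - Q)" for i
      proof -
        define g where "g = (\<lambda>(p :: int ^ 'd, t :: nat). p + axis i (int t * sg S i))"
        have div_eq: "(p $ i + int t * sg S i) div int s = p $ i div int s"
          if "p \<in> far i" "t \<le> L" for p t
        proof -
          have eqL: "(p $ i + int L * sg S i) div int s = p $ i div int s" using that by (simp add: far_def)
          show ?thesis
          proof (cases "i \<in> S")
            case True
            have "p $ i div int s \<le> (p $ i + int t) div int s"
              "(p $ i + int t) div int s \<le> (p $ i + int L) div int s"
              by (intro zdiv_mono1; use s that in simp)+
            then show ?thesis using eqL True by (simp add: sg_def)
          next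
            case False
            have "(p $ i - int t) div int s \<le> p $ i div int s"
              "(p $ i - int L) div int s \<le> (p $ i - int t) div int s"
              by (intro zdiv_mono1; use s that in simp)+
            then show ?thesis using eqL False by (simp add: sg_def)
          qed
        qed
        have block: "block p (g (p, t))" if "p \<in> far i" "t \<le> L" for p t
          using div_eq[OF that] by (auto simp: block_def g_def axis_def)
        have le_g: "le S (g (p, t)) (g (p, t'))" if "t \<le> t'" for p t t'
          using that by (auto simp: le_def g_def axis_def sg_def)
        have g0: "g (p, 0) = p" for p by (simp add: g_def vec_eq_iff axis_def)
        have "card (far i \<times> {1..L}) \<le> card (grid m - Q)"
        proof (rule card_inj_on_le[where f = g])
          have wlog: "p = p' \<and> t = t'"
            if pt: "p \<in> far i" "p' \<in> far i" "1 \<le> t" "t \<le> t'" "t' \<le> L" "g (p, t) = g (p', t')" for p p' t t'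
          proof -
            have pe: "p = g (p', t' - t)"
            proof -
              have "int (t' - t) = int t' - int t" using pt(4) by simp
              then have "g (p', t' - t) = g (p', t') - axis i (int t * sg S i)"
                by (auto simp: g_def vec_eq_iff axis_def left_diff_distrib)
              also have "\<dots> = p" using pt(6) by (simp add: g_def diff_eq_eq)
              finally show ?thesis by simp
            qed
            have "le S p' (g (p', t' - t))" using le_g[of 0 "t' - t" p'] g0 by simp
            moreover have "block p' (g (p', t' - t))" using block[OF pt(2), of "t' - t"] pt(5) by simp
            ultimately have "le S p' p" "block p' p" by (simp_all flip: pe)
            moreover have "p' \<in> M S" "p \<in> Q" using pt MQ by (auto simp: far_def)
            ultimately have "p = p'" unfolding M_def by blast
            moreover have "t = t'"
            proof -
              have "g (p, t) $ i = g (p, t') $ i" using pt(6) \<open>p = p'\<close> by simp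
              then show ?thesis by (auto simp: g_def axis_def sg_def split: if_splits)
            qed
            ultimately show ?thesis by simp
          qed
          show "inj_on g (far i \<times> {1..L})"
          proof (rule inj_onI)
            fix u v assume "u \<in> far i \<times> {1..L}" "v \<in> far i \<times> {1..L}" "g u = g v"
            moreover obtain p t p' t' where "u = (p, t)" "v = (p', t')" by fastforce
            ultimately show "u = v"
              using wlog[of p p' t t'] wlog[of p' p t' t] by (cases "t \<le> t'") auto
          qed
          show "g ` (far i \<times> {1..L}) \<subseteq> grid m - Q"
          proof (rule image_subsetI)
            fix u assume "u \<in> far i \<times> {1..L}"
            then obtain p t where u: "u = (p, t)" "p \<in> far i" "1 \<le> t" "t \<le> L" by fastforce
            have pM: "p \<in> M S" using u by (simp add: far_def)
            have pm: "p \<in> grid m" using pM MQ Q by (auto simp: m_def)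
            have bl: "block p (g (p, t))" using block u by simp
            have "0 \<le> g (p, t) $ j \<and> g (p, t) $ j < int m" for j
            proof -
              have e: "p $ j div int s = g (p, t) $ j div int s" using bl by (simp add: block_def)
              have "0 \<le> p $ j \<and> p $ j < int b * int s" using pm by (simp add: grid_def m_def)
              then have "0 \<le> p $ j div int s \<and> p $ j div int s < int b"
                using s int_div_less_iff pos_imp_zdiv_nonneg_iff by (metis of_nat_0_less_iff)
              then have "0 \<le> g (p, t) $ j div int s \<and> g (p, t) $ j div int s < int b"
                using e by simp
              then have "0 \<le> g (p, t) $ j \<and> g (p, t) $ j < int b * int s"
                using s int_div_less_iff pos_imp_zdiv_nonneg_iff by (metis of_nat_0_less_iff)
              then show ?thesis by (simp add: m_def)
            qed
            then have "g (p, t) \<in> grid m" by (simp add: grid_def)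
            moreover have "g (p, t) \<notin> Q"
            proof
              assume "g (p, t) \<in> Q"
              moreover have "le S p (g (p, t))" using le_g[of 0 t p] g0 by simp
              ultimately have "g (p, t) = p" using pM bl by (auto simp: M_def)
              then have "g (p, t) $ i = p $ i" by simp
              then show False using u(3) by (auto simp: g_def axis_def sg_def split: if_splits)
            qed
            ultimately show "g u \<in> grid m - Q" using u by simp
          qed
          show "finite (grid m - Q)" using finite_grid by blast
        qed
        then show ?thesis by (simp add: card_cartesian_product mult.commute)
      qed
      have "M S \<subseteq> near \<union> (\<Union>i. far i)"
      proof
        fix p assume p: "p \<in> M S"
        then have "p \<in> grid (b * s)" using MQ Q by blast
        then show "p \<in> near \<union> (\<Union>i. far i)"
          using p by (auto simp: near_def far_def grid_def)
      qed
      then have "card (M S) \<le> card (near \<union> (\<Union>i. far i))"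
        using near_fin finM by (intro card_mono) (auto simp: far_def)
      also have "\<dots> \<le> card near + card (\<Union>i. far i)" by (rule card_Un_le)
      also have "\<dots> \<le> (b * L) ^ CARD('d) + (\<Sum>i\<in>UNIV. card (far i))"
        using near_card card_UN_le[of "UNIV :: 'd set" far] by simp
      finally have "L * card (M S) \<le> L * ((b * L) ^ CARD('d) + (\<Sum>i\<in>UNIV. card (far i)))"
        by (rule mult_le_mono2)
      also have "\<dots> = L * (b * L) ^ CARD('d) + (\<Sum>i\<in>UNIV. L * card (far i))"
        by (simp add: distrib_left sum_distrib_left)
      also have "(\<Sum>i\<in>UNIV. L * card (far i)) \<le> (\<Sum>i\<in>(UNIV :: 'd set). card (grid m - Q))"
        by (intro sum_mono far_card)
      finally show ?thesis by simp
    qed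
    note MS = this
    have "L * card P \<le> L * (\<Sum>S\<in>UNIV. card (M S))"
      unfolding P_def by (intro mult_le_mono2 card_UN_le) simp
    also have "\<dots> = (\<Sum>S\<in>UNIV. L * card (M S))" by (rule sum_distrib_left)
    also have "\<dots> \<le> (\<Sum>S\<in>(UNIV :: 'd set set). L * (b * L) ^ CARD('d) + CARD('d) * card (grid m - Q))"
      by (intro sum_mono MS)
    also have "\<dots> = 2 ^ CARD('d) * (L * (b * L) ^ CARD('d) + CARD('d) * card (grid m - Q))"
      using card_Pow[of "UNIV :: 'd set"] by simp
    finally show ?thesis .
  qed
  moreover have "P \<subseteq> Q" by (auto simp: P_def M_def)
  ultimately show ?thesis unfolding m_def by blast
qed

definition patterns_with_windows :: "nat \<Rightarrow> nat \<Rightarrow> nat \<Rightarrow> ('a, 'd::finite) config set" where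
  "patterns_with_windows n m j = {u \<in> patterns (m + n - 1). card (window n u ` grid m) = j}"

text \<open>A pair \<open>(p, q)\<close> of \<open>G\<close> says that the window at \<open>p\<close> repeats the one at the earlier position \<open>q\<close>.
  Hence every letter outside \<open>unlinked\<close> is a copy of an earlier letter.\<close>

definition linked :: "nat \<Rightarrow> (int ^ 'd \<Rightarrow> int) \<Rightarrow> ((int ^ 'd) \<times> (int ^ 'd)) set \<Rightarrow> ('a, 'd::finite) config \<Rightarrow> bool" where
  "linked n \<phi> G u \<longleftrightarrow> (\<forall>(p, q)\<in>G. \<phi> q < \<phi> p \<and> window n u p = window n u q)"

definition unlinked :: "nat \<Rightarrow> nat \<Rightarrow> ((int ^ 'd::finite) \<times> (int ^ 'd)) set \<Rightarrow> (int ^ 'd) set" where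
  "unlinked n m G = cube (m + n - 1) - {p + c | p c. p \<in> fst ` G \<and> c \<in> cube n}"

lemma grid_plus_cube: "p \<in> grid m \<Longrightarrow> c \<in> cube n \<Longrightarrow> p + c \<in> cube (m + n - 1)"
proof -
  assume p: "p \<in> grid m" and c: "c \<in> cube n"
  have "1 \<le> (p + c) $ i \<and> (p + c) $ i \<le> int (m + n - 1)" for i
  proof -
    have "0 \<le> p $ i" "p $ i < int m" "1 \<le> c $ i" "c $ i \<le> int n"
      using p c by (auto simp: grid_def cube_def)
    then show ?thesis unfolding vector_add_component by linarith
  qed
  then show ?thesis by (simp add: cube_def)
qed

section \<open>Encoding a pattern by links and free letters\<close>

text \<open>A linked letter \<open>p + c\<close> copies \<open>q + c\<close>, and additivity of
  \<phi> passes \<open>\<phi> q < \<phi> p\<close> on to these two letters. The descent ends because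
  \<phi> is nonnegative on the box.\<close>

lemma linked_determined:
  fixes u v :: "('a, 'd::finite) config"
  assumes \<phi>: "\<And>r. r \<in> cube (m + n - 1) \<Longrightarrow> 0 \<le> \<phi> r" "\<And>p q. \<phi> (p + q) = \<phi> p + \<phi> q"
    and G: "G \<subseteq> grid m \<times> grid m" and uv: "linked n \<phi> G u" "linked n \<phi> G v"
    and eq: "\<And>r. r \<in> unlinked n m G \<Longrightarrow> u r = v r"
    and r: "r \<in> cube (m + n - 1)"
  shows "u r = v r"
  using r
proof (induction "nat (\<phi> r)" arbitrary: r rule: less_induct)
  case less
  show ?case
  proof (cases "r \<in> unlinked n m G")
    case False
    then obtain p q c where r: "(p, q) \<in> G" "c \<in> cube n" "r = p + c"
      using less.prems by (auto simp: unlinked_def)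
    then have mem: "q + c \<in> cube (m + n - 1)" using G by (intro grid_plus_cube) auto
    have "\<phi> q < \<phi> p" "u (p + c) = u (q + c)" "v (p + c) = v (q + c)"
      using uv r by (auto simp: linked_def window_eq_iff)
    moreover from this have "nat (\<phi> (q + c)) < nat (\<phi> r)"
      using \<phi>(1)[OF less.prems] \<phi>(1)[OF mem] by (simp add: r(3) \<phi>(2))
    then have "u (q + c) = v (q + c)" using less.hyps mem by blast
    ultimately show ?thesis by (simp add: r(3))
  qed (rule eq)
qed

text \<open>\<open>R\<close> collects the first occurrences in the order given by \<phi>, one for
  each distinct window. Links at the covering positions \<open>P\<close> reach every letter of every
  repeated window, so windows through an unlinked letter start in \<open>R\<close>, and
  \<open>card_letters_le\<close> applies.\<close>

lemma exists_links:
  fixes u :: "('a, 'd::finite) config"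
  assumes \<phi>: "inj_on \<phi> (grid m)" and m: "m = b * s" and s: "0 < s" "2 * s \<le> n"
    and K: "K * (n - 1) \<le> m"
    and j: "card (window n u ` grid m) = j"
    and T: "2 ^ CARD('d) * (L * (b * L) ^ CARD('d) + CARD('d) * j) \<le> L * T" and L: "0 < L"
  shows "\<exists>G \<subseteq> grid m \<times> grid m. card G \<le> T \<and> linked n \<phi> G u \<and>
    card (unlinked n m G) * K ^ CARD('d) \<le> (K + 1) ^ CARD('d) * j"
proof -
  define R where "R = {p \<in> grid m. \<forall>q\<in>grid m. window n u q = window n u p \<longrightarrow> \<phi> p \<le> \<phi> q}"
  define Q where "Q = grid m - R"
  have R: "R \<subseteq> grid m" "grid m - Q = R" by (auto simp: R_def Q_def)
  have finR: "finite R" using R finite_grid finite_subset by blast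
  have "inj_on (window n u) R"
  proof (rule inj_onI)
    fix p q assume pq: "p \<in> R" "q \<in> R" "window n u p = window n u q"
    then have "\<phi> p = \<phi> q" unfolding R_def by (metis (mono_tags, lifting) mem_Collect_eq order_antisym)
    then show "p = q" using pq R \<phi> by (meson inj_onD subsetD)
  qed
  then have "card R = card (window n u ` R)" by (simp add: card_image)
  also have "\<dots> \<le> j" unfolding j[symmetric] using R by (intro card_mono finite_imageI finite_grid image_mono)
  finally have Rj: "card R \<le> j" .
  have "\<exists>q. q \<in> grid m \<and> \<phi> q < \<phi> p \<and> window n u p = window n u q" if "p \<in> Q" for p
    using that by (auto simp: Q_def R_def not_le intro: exI)
  then obtain rep where rep: "\<And>p. p \<in> Q \<Longrightarrow> rep p \<in> grid m \<and> \<phi> (rep p) < \<phi> p \<and> window n u p = window n u (rep p)"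
    by metis
  have "Q \<subseteq> grid (b * s)" by (auto simp: Q_def m)
  from exists_small_cover[OF this s, of L]
  obtain P where P: "P \<subseteq> Q" "\<And>p c. p \<in> Q \<Longrightarrow> c \<in> cube n \<Longrightarrow> \<exists>p'\<in>P. \<exists>c'\<in>cube n. p + c = p' + c'"
    "L * card P \<le> 2 ^ CARD('d) * (L * (b * L) ^ CARD('d) + CARD('d) * card R)"
    using R(2) by (auto simp: m)
  define G where "G = (\<lambda>p. (p, rep p)) ` P"
  have "L * card P \<le> L * T"
  proof -
    have "2 ^ CARD('d) * (L * (b * L) ^ CARD('d) + CARD('d) * card R)
        \<le> 2 ^ CARD('d) * (L * (b * L) ^ CARD('d) + CARD('d) * j)"
      using Rj by (intro mult_le_mono2 add_left_mono)
    then show ?thesis using P(3) T by linarith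
  qed
  then have "card P \<le> T" using L by simp
  moreover have "card G \<le> card P" unfolding G_def
    by (rule card_image_le) (use P(1) finite_grid in \<open>auto simp: Q_def intro: finite_subset\<close>)
  ultimately have "card G \<le> T" by simp
  moreover have "G \<subseteq> grid m \<times> grid m" using P(1) rep by (auto simp: G_def Q_def)
  moreover have "linked n \<phi> G u" using P(1) rep by (auto simp: G_def linked_def)
  moreover have "card (unlinked n m G) * K ^ CARD('d) \<le> (K + 1) ^ CARD('d) * j"
  proof -
    have "card (unlinked n m G) * K ^ CARD('d) \<le> (K + 1) ^ CARD('d) * card R"
    proof (rule card_letters_le[OF _ finR _ _ K])
      show "unlinked n m G \<subseteq> cube (m + n - 1)" by (auto simp: unlinked_def)
      show "1 \<le> n" using s by simp
      fix p c assume p: "p \<in> grid m" "c \<in> cube n" "p + c \<in> unlinked n m G"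
      show "p \<in> R"
      proof (rule ccontr)
        assume "p \<notin> R"
        then have "p \<in> Q" using p by (simp add: Q_def)
        then obtain p' c' where "p' \<in> P" "c' \<in> cube n" "p + c = p' + c'" using P(2) p by blast
        moreover have "fst ` G = P" by (force simp: G_def)
        ultimately show False using p(3) unfolding unlinked_def by blast
      qed
    qed
    also have "\<dots> \<le> (K + 1) ^ CARD('d) * j" using Rj by (rule mult_le_mono2)
    finally show ?thesis .
  qed
  ultimately show ?thesis by blast
qed

text \<open>The notion of "earlier" for links: injectivity makes first occurrences unique,
  additivity lets a link act on all letters of a window alike, and nonnegativity makes chains of
  copies end.\<close>

lemma ex_injective_functional:
  "\<exists>\<phi> :: int ^ 'd::finite \<Rightarrow> int. (\<forall>p q. \<phi> (p + q) = \<phi> p + \<phi> q) \<and> inj_on \<phi> (grid m) \<and>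
    (\<forall>r. (\<forall>i. 0 \<le> r $ i) \<longrightarrow> 0 \<le> \<phi> r)"
proof -
  from ex_separating_weights[OF of_nat_0_le_iff[of m]]
  obtain w :: "'d \<Rightarrow> int" where w: "\<forall>i. 0 \<le> w i"
    "\<forall>\<delta>. (\<forall>i. \<bar>\<delta> i\<bar> \<le> int m) \<longrightarrow> (\<Sum>i\<in>UNIV. w i * \<delta> i) = 0 \<longrightarrow> (\<forall>i. \<delta> i = 0)"
    by blast
  define \<phi> where "\<phi> = (\<lambda>p :: int ^ 'd. \<Sum>i\<in>UNIV. w i * p $ i)"
  have add: "\<phi> (p + q) = \<phi> p + \<phi> q" for p q
    by (simp add: \<phi>_def distrib_left sum.distrib)
  have "inj_on \<phi> (grid m)"
  proof (rule inj_onI)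
    fix p q assume pq: "p \<in> grid m" "q \<in> grid m" "\<phi> p = \<phi> q"
    have "\<bar>p $ i - q $ i\<bar> \<le> int m" for i
    proof -
      have "0 \<le> p $ i" "p $ i < int m" "0 \<le> q $ i" "q $ i < int m"
        using pq by (auto simp: grid_def)
      then show ?thesis by linarith
    qed
    moreover have "(\<Sum>i\<in>UNIV. w i * (p $ i - q $ i)) = 0"
      using pq(3) by (simp add: \<phi>_def right_diff_distrib sum_subtractf)
    ultimately have "p $ i - q $ i = 0" for i
      using w(2)[rule_format, of "\<lambda>i. p $ i - q $ i"] by blast
    then show "p = q" by (simp add: vec_eq_iff)
  qed
  moreover have "0 \<le> \<phi> r" if "\<forall>i. 0 \<le> r $ i" for r
    unfolding \<phi>_def using that w(1) by (intro sum_nonneg) simp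
  ultimately show ?thesis using add by blast
qed

text \<open>The first factor bounds the choices of at most \<open>T\<close> links among
  \<open>m ^ (2 * CARD('d))\<close> pairs of positions, the second the letters outside the linked
  windows.\<close>

lemma card_patterns_with_windows_le:
  assumes m: "m = b * s" and s: "0 < s" "2 * s \<le> n"
    and K: "K * (n - 1) \<le> m" "0 < K"
    and T: "2 ^ CARD('d) * (L * (b * L) ^ CARD('d) + CARD('d) * j) \<le> L * T" and L: "0 < L"
  shows "card (patterns_with_windows n m j :: ('a::finite, 'd::finite) config set)
    \<le> (m ^ (2 * CARD('d)) + 1) ^ T * CARD('a) ^ (((K + 1) ^ CARD('d) * j) div K ^ CARD('d))"
proof -
  obtain \<phi> :: "int ^ 'd \<Rightarrow> int" where \<phi>: "\<And>p q. \<phi> (p + q) = \<phi> p + \<phi> q" "inj_on \<phi> (grid m)"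
    "\<And>r. (\<forall>i. 0 \<le> r $ i) \<Longrightarrow> 0 \<le> \<phi> r"
    using ex_injective_functional by metis
  have \<phi>0: "0 \<le> \<phi> r" if "r \<in> cube k" for r k
    using that by (intro \<phi>(3)) (auto simp: cube_def intro: order_trans[of 0 1])
  define V where "V = ((K + 1) ^ CARD('d) * j) div K ^ CARD('d)"
  let ?S = "grid m \<times> grid m :: ((int ^ 'd) \<times> (int ^ 'd)) set"
  define \<G> where "\<G> = {G. G \<subseteq> ?S \<and> card G \<le> T}"
  define \<G>' where "\<G>' = {G \<in> \<G>. card (unlinked n m G) \<le> V}"
  have finG: "finite \<G>" unfolding \<G>_def
    by (rule finite_subset[of _ "Pow ?S"]) (auto simp: finite_grid)
  define F :: "((int ^ 'd) \<times> (int ^ 'd)) set \<Rightarrow> ('a, 'd) config set"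
    where "F = (\<lambda>G. {u \<in> patterns (m + n - 1). linked n \<phi> G u})"
  have sub: "(patterns_with_windows n m j :: ('a, 'd) config set) \<subseteq> (\<Union>G\<in>\<G>'. F G)"
  proof
    fix u :: "('a, 'd) config" assume u: "u \<in> patterns_with_windows n m j"
    then have j: "card (window n u ` grid m) = j" by (simp add: patterns_with_windows_def)
    from exists_links[OF \<phi>(2) m s K(1) j T L]
    obtain G where G: "G \<subseteq> ?S" "card G \<le> T" "linked n \<phi> G u"
      "card (unlinked n m G) * K ^ CARD('d) \<le> (K + 1) ^ CARD('d) * j" by blast
    have "card (unlinked n m G) \<le> V"
      unfolding V_def using G(4) K(2) by (simp add: less_eq_div_iff_mult_less_eq)
    then have "G \<in> \<G>'" using G by (simp add: \<G>'_def \<G>_def)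
    moreover have "u \<in> F G" using u G by (simp add: F_def patterns_with_windows_def)
    ultimately show "u \<in> (\<Union>G\<in>\<G>'. F G)" by blast
  qed
  have cardF: "card (F G) \<le> CARD('a) ^ V" if G: "G \<in> \<G>'" for G
  proof -
    have fin: "finite (unlinked n m G)" unfolding unlinked_def using finite_cube by blast
    have "card (F G) \<le> card (unlinked n m G \<rightarrow>\<^sub>E (UNIV :: 'a set))"
    proof (rule card_inj_on_le[where f = "\<lambda>u. restrict u (unlinked n m G)"])
      show "inj_on (\<lambda>u. restrict u (unlinked n m G)) (F G)"
      proof (rule inj_onI)
        fix u v assume u: "u \<in> F G" and v: "v \<in> F G"
          and eq: "restrict u (unlinked n m G) = restrict v (unlinked n m G)"
        have "u r = v r" if r: "r \<in> cube (m + n - 1)" for r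
        proof (rule linked_determined[where \<phi> = \<phi> and G = G and n = n and m = m, OF \<phi>0 \<phi>(1) _ _ _ _ r])
          show "G \<subseteq> ?S" using G by (simp add: \<G>'_def \<G>_def)
          show "linked n \<phi> G u" "linked n \<phi> G v" using u v by (simp_all add: F_def)
          show "\<And>r. r \<in> unlinked n m G \<Longrightarrow> u r = v r" using eq by (simp add: restrict_eq_iff)
        qed
        then show "u = v" using u v
          by (auto simp: F_def patterns_def intro: PiE_ext)
      qed
      show "finite (unlinked n m G \<rightarrow>\<^sub>E (UNIV :: 'a set))" using fin by (intro finite_PiE) auto
    qed auto
    also have "\<dots> = CARD('a) ^ card (unlinked n m G)" using fin by (simp add: card_PiE)
    also have "\<dots> \<le> CARD('a) ^ V"
      using G by (intro power_increasing) (auto simp: \<G>'_def Suc_le_eq)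
    finally show ?thesis .
  qed
  have "card (patterns_with_windows n m j :: ('a, 'd) config set) \<le> card (\<Union>G\<in>\<G>'. F G)"
  proof (rule card_mono[OF _ sub])
    show "finite (\<Union>G\<in>\<G>'. F G)"
      by (rule finite_subset[OF _ finite_patterns[of "m + n - 1"]]) (auto simp: F_def)
  qed
  also have "\<dots> \<le> (\<Sum>G\<in>\<G>'. card (F G))"
    using finG by (intro card_UN_le) (simp add: \<G>'_def)
  also have "\<dots> \<le> (\<Sum>G\<in>\<G>'. CARD('a) ^ V)" by (intro sum_mono cardF)
  also have "\<dots> = card \<G>' * CARD('a) ^ V" by simp
  also have "\<dots> \<le> (m ^ (2 * CARD('d)) + 1) ^ T * CARD('a) ^ V"
  proof (rule mult_le_mono1)
    have "card \<G>' \<le> card \<G>" using finG by (intro card_mono) (auto simp: \<G>'_def)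
    also have "\<dots> \<le> (card ?S + 1) ^ T"
      unfolding \<G>_def by (rule card_small_subsets_le) (simp add: finite_grid)
    also have "card ?S = m ^ (2 * CARD('d))"
      by (simp add: card_cartesian_product card_grid mult_2 power_add)
    finally show "card \<G>' \<le> (m ^ (2 * CARD('d)) + 1) ^ T" .
  qed
  finally show ?thesis by (simp add: V_def)
qed

section \<open>Asymptotics of the pattern count\<close>

lemma ln_times_powr_le:
  fixes c \<epsilon> \<delta> :: real
  assumes "0 < \<epsilon>" "0 < \<delta>"
  shows "\<forall>\<^sub>F n::nat in sequentially. c * ln n * n powr - \<delta> \<le> \<epsilon>"
proof -
  have "(\<lambda>n. c * (ln (real n) / real n powr \<delta>)) \<longlonglongrightarrow> c * 0"
    by (intro tendsto_mult tendsto_const lim_ln_over_power assms)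
  then have "\<forall>\<^sub>F n in sequentially. c * (ln (real n) / real n powr \<delta>) < \<epsilon>"
    using assms by (intro order_tendstoD(2)) simp_all
  then show ?thesis
    by eventually_elim (simp add: powr_minus divide_inverse mult.assoc)
qed

text \<open>This choice of \<open>L\<close> makes the block-end term of order n^(1/2) and the run
  term of order j * n^(-1/(2d)). As \<open>n \<le> 2 * j\<close>, both are within a constant factor
  of j * n^(-1/(2d)).\<close>

lemma cover_size_le:
  fixes n j b d L :: nat
  assumes L: "L = nat \<lceil>real n powr (1 / (2 * real d))\<rceil>" and n: "2 \<le> n" "n \<le> 2 * j"
    and d: "1 \<le> d" and b: "1 \<le> b"
  shows "real (2 ^ d * ((b * L) ^ d + d * j div L + 1))
    \<le> 2 ^ d * (4 * (2 * real b) ^ d + d) * real n powr - (1 / (2 * real d)) * j"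
proof -
  define \<delta> where "\<delta> = 1 / (2 * real d)"
  have \<delta>: "0 < \<delta>" "\<delta> \<le> 1 / 2" using d by (auto simp: \<delta>_def field_simps)
  have n1: "1 \<le> real n powr \<delta>" using n \<delta> by (intro ge_one_powr_ge_zero) auto
  have L1: "real n powr \<delta> \<le> real L" and L2: "real L \<le> 2 * real n powr \<delta>"
    unfolding L \<delta>_def[symmetric] using n1 by linarith+
  have Lpos: "1 \<le> L" using L1 n1 by linarith
  have "real ((b * L) ^ d) \<le> (real b * (2 * real n powr \<delta>)) ^ d"
    unfolding of_nat_power of_nat_mult using L2 by (intro power_mono mult_left_mono) auto
  also have "\<dots> = (2 * real b) ^ d * (real n powr \<delta>) ^ d"
    by (simp add: power_mult_distrib)
  also have "(real n powr \<delta>) ^ d = real n powr (1 / 2)"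
    using n d by (simp add: powr_realpow[symmetric] powr_powr \<delta>_def)
  finally have A1: "real ((b * L) ^ d) \<le> (2 * real b) ^ d * real n powr (1 / 2)" .
  have "real n powr (1 / 2) = real n * real n powr - (1 / 2)"
    using n by (simp add: powr_mult_base)
  also have "\<dots> \<le> (2 * real j) * real n powr - \<delta>"
    using n \<delta> by (intro mult_mono powr_mono) auto
  finally have A2: "real n powr (1 / 2) \<le> (2 * real j) * real n powr - \<delta>" .
  have A: "real ((b * L) ^ d) \<le> (2 * real b) ^ d * ((2 * real j) * real n powr - \<delta>)"
    by (rule order_trans[OF A1 mult_left_mono[OF A2]]) simp
  have "real (d * j div L) \<le> real (d * j) / real L" by (rule of_nat_div_le_of_nat)
  also have "\<dots> \<le> real (d * j) / real n powr \<delta>"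
    using L1 n1 Lpos n by (intro divide_left_mono mult_pos_pos) auto
  also have "\<dots> = real d * (real j * real n powr - \<delta>)" by (simp add: powr_minus divide_inverse)
  finally have B: "real (d * j div L) \<le> real d * (real j * real n powr - \<delta>)" .
  have "1 \<le> (b * L) ^ d" using Lpos b by simp
  then have "1 \<le> real ((b * L) ^ d)" by linarith
  then have "real ((b * L) ^ d + d * j div L + 1) \<le> 2 * real ((b * L) ^ d) + real (d * j div L)"
    by simp
  also have "\<dots> \<le> (4 * (2 * real b) ^ d + d) * (real j * real n powr - \<delta>)"
    using A B by (simp add: algebra_simps)
  finally have "2 ^ d * real ((b * L) ^ d + d * j div L + 1)
      \<le> 2 ^ d * ((4 * (2 * real b) ^ d + d) * (real j * real n powr - \<delta>))"
    by (intro mult_left_mono) auto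
  moreover have "real (2 ^ d * ((b * L) ^ d + d * j div L + 1)) = 2 ^ d * real ((b * L) ^ d + d * j div L + 1)"
    by (simp only: of_nat_mult of_nat_power of_nat_numeral)
  ultimately show ?thesis by (simp only: \<delta>_def mult_ac)
qed

text \<open>The number of links is of order j * n^(-1/(2d)) and each has polynomially many choices,
  so all links together cost at most \<open>\<eta> ^ j\<close>. The estimate is uniform in
  \<open>j\<close>, because it will be summed over all \<open>j\<close> from n/2 on.\<close>

lemma patterns_with_windows_asymptotic:
  fixes \<eta> :: real
  assumes \<eta>: "1 < \<eta>" and K: "0 < K"
  shows "\<forall>\<^sub>F n in sequentially. \<forall>j. n \<le> 2 * j \<longrightarrow>
    real (card (patterns_with_windows n (2 * K * (n div 2)) j :: ('a::finite, 'd::finite) config set))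
    \<le> (\<eta> * real CARD('a) powr ((1 + 1 / K) ^ CARD('d))) ^ j"
proof -
  define d where "d = CARD('d)"
  have d: "1 \<le> d" by (simp add: d_def Suc_le_eq)
  define \<delta> where "\<delta> = 1 / (2 * real d)"
  define c :: real where "c = 2 ^ d * (4 * (2 * real (2 * K)) ^ d + d)"
  have "0 < \<delta>" using d by (simp add: \<delta>_def)
  then have "\<forall>\<^sub>F n::nat in sequentially. (4 * d + 1) * c * ln n * n powr - \<delta> \<le> ln \<eta>"
    using \<eta> by (intro ln_times_powr_le) auto
  moreover have "\<forall>\<^sub>F n::nat in sequentially. max 2 K \<le> n" by (rule eventually_ge_at_top)
  ultimately show ?thesis
  proof eventually_elim
    case (elim n)
    show ?case
    proof (intro allI impI)
      fix j :: nat assume j: "n \<le> 2 * j"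
      have n: "2 \<le> n" "K \<le> n" using elim by auto
      define L where "L = nat \<lceil>real n powr (1 / (2 * real d))\<rceil>"
      have "0 < real n powr (1 / (2 * real d))" using n by simp
      then have L: "0 < L" unfolding L_def by linarith
      \<comment> \<open>The \<open>+ 1\<close> rounds \<open>d * j / L\<close> up; the blocks have
        side \<open>n div 2\<close>, with \<open>2 * K\<close> of them along each axis.\<close>
      define T where "T = 2 ^ d * ((2 * K * L) ^ d + d * j div L + 1)"
      define m where "m = 2 * K * (n div 2)"
      have "d * j \<le> L * (d * j div L) + L"
        using mod_less_divisor[OF L, of "d * j"] mult_div_mod_eq[of L "d * j"] by linarith
      then have "2 ^ d * (L * (2 * K * L) ^ d + d * j) \<le> 2 ^ d * (L * (2 * K * L) ^ d + (L * (d * j div L) + L))"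
        by (intro mult_le_mono2 add_left_mono)
      also have "\<dots> = L * T" by (simp add: T_def algebra_simps)
      finally have T: "2 ^ d * (L * (2 * K * L) ^ d + d * j) \<le> L * T" .
      have "n - 1 \<le> 2 * (n div 2)" by linarith
      then have "K * (n - 1) \<le> K * (2 * (n div 2))" by (rule mult_le_mono2)
      then have Km: "K * (n - 1) \<le> m" by (simp add: m_def)
      define V where "V = ((K + 1) ^ d * j) div K ^ d"
      have "card (patterns_with_windows n m j :: ('a, 'd) config set)
          \<le> (m ^ (2 * d) + 1) ^ T * CARD('a) ^ V"
        unfolding d_def V_def
        by (rule card_patterns_with_windows_le[OF m_def _ _ Km K T[unfolded d_def] L]) (use n in auto)
      then have "real (card (patterns_with_windows n m j :: ('a, 'd) config set))
          \<le> real ((m ^ (2 * d) + 1) ^ T * CARD('a) ^ V)"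
        by (simp only: of_nat_le_iff)
      also have "\<dots> = real (m ^ (2 * d) + 1) ^ T * real CARD('a) ^ V"
        by (simp only: of_nat_mult of_nat_power)
      also have "\<dots> \<le> \<eta> ^ j * (real CARD('a) powr ((1 + 1 / K) ^ d)) ^ j"
      proof (intro mult_mono)
        have "m \<le> K * n" unfolding m_def by (simp add: mult.assoc)
        also have "\<dots> \<le> n ^ 2" using n by (simp add: power2_eq_square)
        finally have "m ^ (2 * d) \<le> (n ^ 2) ^ (2 * d)" by (rule power_mono) simp
        also have "\<dots> = n ^ (4 * d)" by (simp flip: power_mult)
        finally have "m ^ (2 * d) + 1 \<le> n ^ (4 * d) + n ^ (4 * d)" using n by (intro add_mono) auto
        also have "\<dots> \<le> n * n ^ (4 * d)" using n by (simp flip: mult_2)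
        finally have "m ^ (2 * d) + 1 \<le> n ^ (4 * d + 1)" by simp
        then have "real (m ^ (2 * d) + 1) \<le> real n ^ (4 * d + 1)"
          by (simp only: of_nat_le_iff flip: of_nat_power)
        then have "ln (real (m ^ (2 * d) + 1)) \<le> ln (real n ^ (4 * d + 1))"
          by (intro ln_mono) (auto simp: add_pos_nonneg)
        also have "\<dots> = (4 * d + 1) * ln n" 
          using n by (subst ln_realpow) simp_all
        finally have l: "ln (real (m ^ (2 * d) + 1)) \<le> (4 * d + 1) * ln n" .
        have T_le: "real T \<le> c * n powr - \<delta> * j"
          unfolding T_def c_def \<delta>_def using cover_size_le[OF L_def n(1) j d, of "2 * K"] K by simp
        have "ln (real (m ^ (2 * d) + 1) ^ T) = T * ln (real (m ^ (2 * d) + 1))"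
          by (subst ln_realpow) auto
        also have "\<dots> \<le> (c * n powr - \<delta> * j) * ((4 * d + 1) * ln n)"
          using T_le l by (intro mult_mono) (auto simp: c_def)
        also have "\<dots> = ((4 * d + 1) * c * ln n * n powr - \<delta>) * j" by (simp add: mult_ac)
        also have "\<dots> \<le> ln \<eta> * j" using elim(1) by (intro mult_right_mono) auto
        also have "\<dots> = ln (\<eta> ^ j)" using \<eta> by (simp add: ln_realpow)
        finally show "real (m ^ (2 * d) + 1) ^ T \<le> \<eta> ^ j"
          using \<eta> by (subst (asm) ln_le_cancel_iff) (auto intro!: zero_less_power add_pos_nonneg)
        have "real V \<le> real ((K + 1) ^ d * j) / real (K ^ d)"
          unfolding V_def by (rule of_nat_div_le_of_nat)
        also have "\<dots> = (1 + 1 / K) ^ d * j"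
        proof -
          have "(1 + 1 / real K) ^ d = (real (K + 1) / real K) ^ d"
            using K by (simp add: add_divide_distrib add.commute)
          then show ?thesis by (simp add: power_divide)
        qed
        finally have "real CARD('a) powr real V \<le> real CARD('a) powr ((1 + 1 / K) ^ d * j)"
          by (intro powr_mono) (auto simp: Suc_le_eq)
        then show "real CARD('a) ^ V \<le> (real CARD('a) powr ((1 + 1 / K) ^ d)) ^ j"
          by (simp add: powr_realpow[symmetric] powr_powr)
      qed (use \<eta> in auto)
      finally show "real (card (patterns_with_windows n (2 * K * (n div 2)) j :: ('a, 'd) config set))
          \<le> (\<eta> * real CARD('a) powr ((1 + 1 / K) ^ CARD('d))) ^ j"
        by (simp add: m_def d_def power_mult_distrib)
    qed
  qed
qed

text \<open>With \<eta> = 1 + 1/K the expression tends to \<alpha> |A| < 1 as K grows. The bound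
  \<open>4 \<le> K\<close> will guarantee a box of side at least 2n.\<close>

lemma exists_growth_rate:
  fixes \<alpha> :: real
  assumes "0 \<le> \<alpha>" "\<alpha> < inverse (real CARD('a))"
  shows "\<exists>K \<eta>. 4 \<le> K \<and> 1 < \<eta> \<and> \<alpha> * (\<eta> * real CARD('a::finite) powr ((1 + 1 / real K) ^ d)) < 1"
proof -
  define N where "N = real CARD('a)"
  have N: "1 \<le> N" by (simp add: N_def Suc_le_eq)
  have "(\<lambda>K. \<alpha> * ((1 + 1 / real K) * N powr ((1 + 1 / real K) ^ d)))
      \<longlonglongrightarrow> \<alpha> * ((1 + 0) * N powr ((1 + 0) ^ d))"
    using N by (intro tendsto_intros lim_1_over_n) auto
  moreover have "\<alpha> * ((1 + 0) * N powr ((1 + 0) ^ d)) < 1"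
    using assms N by (simp add: N_def[symmetric] field_simps)
  ultimately have "\<forall>\<^sub>F K in sequentially. \<alpha> * ((1 + 1 / real K) * N powr ((1 + 1 / real K) ^ d)) < 1"
    by (rule order_tendstoD)
  then have "\<forall>\<^sub>F K in sequentially. 4 \<le> K \<and> \<alpha> * ((1 + 1 / real K) * N powr ((1 + 1 / real K) ^ d)) < 1"
    using eventually_ge_at_top[of 4] by eventually_elim simp
  then obtain K where "4 \<le> K" "\<alpha> * ((1 + 1 / real K) * N powr ((1 + 1 / real K) ^ d)) < 1"
    using eventually_happens'[OF sequentially_bot] by blast
  then show ?thesis unfolding N_def by (intro exI[of _ K] exI[of _ "1 + 1 / real K"]) auto
qed

section \<open>Probability of containing a small orbit\<close>

lemma prob_all_Pi_pmf:
  assumes "finite S" "W \<subseteq> S" and p: "0 \<le> p" "p \<le> 1"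
  shows "measure_pmf.prob (Pi_pmf S False (\<lambda>_. bernoulli_pmf p)) {b. \<forall>u\<in>W. b u} = p ^ card W"
proof -
  let ?B = "\<lambda>u. if u \<in> W then {True} else UNIV"
  have "{b. \<forall>u\<in>W. b u} = Pi S ?B" using assms by (auto simp: Pi_def)
  then have "measure_pmf.prob (Pi_pmf S False (\<lambda>_. bernoulli_pmf p)) {b. \<forall>u\<in>W. b u}
      = (\<Prod>u\<in>S. measure_pmf.prob (bernoulli_pmf p) (?B u))"
    using assms by (simp add: measure_Pi_pmf_Pi)
  also have "\<dots> = (\<Prod>u\<in>S. if u \<in> W then p else 1)"
    using p by (intro prod.cong) (auto simp: measure_pmf_single)
  also have "\<dots> = (\<Prod>u\<in>W. p)"
    using assms by (subst prod.inter_restrict[symmetric]) (auto simp: Int_absorb1 intro!: prod.cong)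
  finally show ?thesis by simp
qed

text \<open>Events that depend on disjoint sets of independent coordinates are independent, so the
  product is exact.\<close>

lemma prob_no_block_Pi_pmf:
  assumes S: "finite S" and \<Gamma>: "finite \<Gamma>" and W: "\<And>\<gamma>. \<gamma> \<in> \<Gamma> \<Longrightarrow> W \<gamma> \<subseteq> S"
    and disj: "disjoint_family_on W \<Gamma>" and p: "0 \<le> p" "p \<le> 1"
  shows "measure_pmf.prob (Pi_pmf S False (\<lambda>_. bernoulli_pmf p)) {b. \<forall>\<gamma>\<in>\<Gamma>. \<not> (\<forall>u\<in>W \<gamma>. b u)}
    = (\<Prod>\<gamma>\<in>\<Gamma>. 1 - p ^ card (W \<gamma>))"
proof (cases "\<Gamma> = {}")
  case True
  then show ?thesis by simp
next
  case False
  define Q where "Q = Pi_pmf S False (\<lambda>_. bernoulli_pmf p)"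
  let ?M = "\<lambda>_. count_space UNIV :: bool measure"
  define X where "X = (\<lambda>\<gamma> b. restrict (\<lambda>u. b u) (W \<gamma>) :: _ \<Rightarrow> bool)"
  define A where "A = (\<lambda>\<gamma>. space (PiM (W \<gamma>) ?M) - (\<Pi>\<^sub>E u\<in>W \<gamma>. {True}))"
  have ind: "prob_space.indep_vars (measure_pmf Q) (\<lambda>\<gamma>. PiM (W \<gamma>) ?M) X \<Gamma>"
    unfolding X_def
    by (rule prob_space.indep_vars_restrict[OF measure_pmf.prob_space_axioms _ W disj]) (auto simp: Q_def intro!: indep_vars_Pi_pmf S)
  have fin: "finite (W \<gamma>)" if "\<gamma> \<in> \<Gamma>" for \<gamma> using W[OF that] S finite_subset by blast
  have A: "A \<gamma> \<in> sets (PiM (W \<gamma>) ?M)" if "\<gamma> \<in> \<Gamma>" for \<gamma>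
    unfolding A_def using fin[OF that] by (intro sets.compl_sets sets_PiM_I_finite) auto
  have vimage: "X \<gamma> -` A \<gamma> \<inter> space (measure_pmf Q) = - {b. \<forall>u\<in>W \<gamma>. b u}" for \<gamma>
    by (auto simp: X_def A_def space_PiM PiE_iff restrict_eq_iff)
  have pr: "measure_pmf.prob Q (- {b. \<forall>u\<in>W \<gamma>. b u}) = 1 - p ^ card (W \<gamma>)" if "\<gamma> \<in> \<Gamma>" for \<gamma>
    using measure_pmf.prob_compl[of "{b. \<forall>u\<in>W \<gamma>. b u}"] prob_all_Pi_pmf[OF S W[OF that] p]
    by (simp add: Q_def Compl_eq_Diff_UNIV)
  have "measure_pmf.prob Q (\<Inter>\<gamma>\<in>\<Gamma>. X \<gamma> -` A \<gamma> \<inter> space (measure_pmf Q))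
      = (\<Prod>\<gamma>\<in>\<Gamma>. measure_pmf.prob Q (X \<gamma> -` A \<gamma> \<inter> space (measure_pmf Q)))"
    by (rule prob_space.indep_varsD_finite[OF measure_pmf.prob_space_axioms ind False \<Gamma> A])
  also have "\<dots> = (\<Prod>\<gamma>\<in>\<Gamma>. 1 - p ^ card (W \<gamma>))"
    unfolding vimage by (intro prod.cong refl pr)
  also have "(\<Inter>\<gamma>\<in>\<Gamma>. X \<gamma> -` A \<gamma> \<inter> space (measure_pmf Q)) = {b. \<forall>\<gamma>\<in>\<Gamma>. \<not> (\<forall>u\<in>W \<gamma>. b u)}"
    unfolding vimage by auto
  finally show ?thesis by (simp add: Q_def)
qed

lemma prob_random_patterns:
  "measure_pmf.prob (random_patterns n \<alpha> :: ('a::finite, 'd::finite) config set pmf) E =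
   measure_pmf.prob (Pi_pmf (patterns n) False (\<lambda>_. bernoulli_pmf \<alpha>)) {b. {u \<in> patterns n. b u} \<in> E}"
  unfolding random_patterns_def by (simp add: vimage_def)

definition orbit_windows :: "nat \<Rightarrow> ('a, 'd::finite) config set \<Rightarrow> ('a, 'd) config set" where
  "orbit_windows n \<gamma> = (\<lambda>y. restrict y (cube n)) ` \<gamma>"

definition small_orbits :: "nat \<Rightarrow> ('a, 'd::finite) config set set" where
  "small_orbits k = {\<gamma> \<in> finite_orbits UNIV. card \<gamma> \<le> k}"

lemma finite_small_orbits: "finite (small_orbits k :: ('a::finite, 'd::finite) config set set)"
proof -
  have "small_orbits k \<subseteq> (\<Union>j\<le>k. {\<gamma> \<in> finite_orbits (UNIV :: ('a, 'd) config set). card \<gamma> = j})"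
    by (auto simp: small_orbits_def)
  then show ?thesis by (rule finite_subset) (simp add: finite_finite_orbits_card)
qed

lemma orbit_windows_patterns: "orbit_windows n \<gamma> \<subseteq> patterns n"
  by (auto simp: orbit_windows_def patterns_def)

lemma finite_orbit_disjoint:
  assumes "finite_orbit \<gamma>" "finite_orbit \<delta>" "\<gamma> \<noteq> \<delta>"
  shows "\<gamma> \<inter> \<delta> = {}"
  using assms unfolding finite_orbit_def by blast

lemma card_finite_orbit_pos: "finite_orbit \<gamma> \<Longrightarrow> 0 < card \<gamma>"
  by (simp add: finite_orbit_def card_gt_0_iff)

lemma finite_orbit_union_inj':
  assumes "finite_orbit \<gamma>" "finite_orbit \<delta>" "card \<gamma> + card \<delta> \<le> n"
  shows "inj_on (\<lambda>y. restrict y (cube n)) (\<gamma> \<union> \<delta>)"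
proof (rule finite_orbit_union_inj[OF assms(1,2)])
  have "finite (\<gamma> \<union> \<delta>)" using assms by (simp add: finite_orbit_def)
  then have "card ((\<lambda>y. restrict y (cube n)) ` (\<gamma> \<union> \<delta>)) \<le> card (\<gamma> \<union> \<delta>)" by (rule card_image_le)
  also have "\<dots> \<le> card \<gamma> + card \<delta>" by (rule card_Un_le)
  finally show "card ((\<lambda>y. restrict y (cube n)) ` (\<gamma> \<union> \<delta>)) \<le> n" using assms by simp
qed

lemma card_orbit_windows:
  assumes "finite_orbit \<gamma>" "2 * card \<gamma> \<le> n"
  shows "card (orbit_windows n \<gamma>) = card \<gamma>"
  unfolding orbit_windows_def using finite_orbit_union_inj'[OF assms(1,1)] assms(2)
  by (simp add: card_image)

text \<open>The union of two such orbits has at most n points, so restriction to the cube is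
  injective on it and keeps disjoint orbits disjoint.\<close>

lemma disjoint_orbit_windows:
  "disjoint_family_on (orbit_windows n) (small_orbits (n div 2) :: ('a, 'd::finite) config set set)"
proof (unfold disjoint_family_on_def, intro ballI impI)
  fix \<gamma> \<delta> :: "('a, 'd) config set"
  assume "\<gamma> \<in> small_orbits (n div 2)" "\<delta> \<in> small_orbits (n div 2)" "\<gamma> \<noteq> \<delta>"
  then have o: "finite_orbit \<gamma>" "finite_orbit \<delta>" "\<gamma> \<inter> \<delta> = {}" "card \<gamma> + card \<delta> \<le> n"
    using finite_orbit_disjoint[of \<gamma> \<delta>] by (auto simp: small_orbits_def finite_orbits_def)
  show "orbit_windows n \<gamma> \<inter> orbit_windows n \<delta> = {}"
    unfolding orbit_windows_def
    using inj_on_image_Int[OF finite_orbit_union_inj'[OF o(1,2,4)], of \<gamma> \<delta>] o(3) by simp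
qed

lemma orbit_windows_subset_imp_nonempty:
  assumes "finite_orbit \<gamma>" "orbit_windows n \<gamma> \<subseteq> \<omega>"
  shows "subshift n \<omega> \<noteq> {}"
proof -
  obtain x where x: "x \<in> \<gamma>" using assms by (auto simp: finite_orbit_def)
  have "restrict (shift p x) (cube n) \<in> \<omega>" for p
    using finite_orbit_shift[OF assms(1) x] assms(2) by (auto simp: orbit_windows_def)
  then show ?thesis by (auto simp: subshift_def)
qed

text \<open>A partial Euler product of the inverse zeta function. The type argument fixes alphabet
  and lattice, which the real value does not reveal.\<close>

definition small_orbit_prod :: "('a, 'd::finite) config itself \<Rightarrow> real \<Rightarrow> nat \<Rightarrow> real" where
  "small_orbit_prod _ \<alpha> k = (\<Prod>\<gamma>\<in>(small_orbits k :: ('a, 'd) config set set). 1 - \<alpha> ^ card \<gamma>)"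

lemma prob_no_small_orbit:
  assumes \<alpha>: "0 \<le> \<alpha>" "\<alpha> \<le> 1"
  shows "measure_pmf.prob (Pi_pmf (patterns n) False (\<lambda>_. bernoulli_pmf \<alpha>))
      {b. \<forall>\<gamma>\<in>small_orbits (n div 2). \<not> (\<forall>u\<in>orbit_windows n \<gamma> :: ('a, 'd) config set. b u)}
    = small_orbit_prod TYPE(('a::finite, 'd::finite) config) \<alpha> (n div 2)"
proof -
  have "card (orbit_windows n \<gamma>) = card \<gamma>" if "\<gamma> \<in> small_orbits (n div 2)" for \<gamma> :: "('a, 'd) config set"
    using that by (intro card_orbit_windows) (auto simp: small_orbits_def finite_orbits_def)
  then show ?thesis
    unfolding small_orbit_prod_def
    by (subst prob_no_block_Pi_pmf[OF finite_patterns finite_small_orbits orbit_windows_patterns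
          disjoint_orbit_windows \<alpha>]) simp
qed

lemma prob_empty_le_small_orbit_prod:
  assumes \<alpha>: "0 \<le> \<alpha>" "\<alpha> \<le> 1"
  shows "measure_pmf.prob (random_patterns n \<alpha>) (emptiness_event n :: ('a::finite, 'd::finite) config set set)
    \<le> small_orbit_prod TYPE(('a, 'd) config) \<alpha> (n div 2)"
proof -
  have "{b. {u \<in> patterns n. b u} \<in> (emptiness_event n :: ('a, 'd) config set set)}
      \<subseteq> {b. \<forall>\<gamma>\<in>small_orbits (n div 2). \<not> (\<forall>u\<in>orbit_windows n \<gamma> :: ('a, 'd) config set. b u)}"
  proof (intro subsetI CollectI ballI notI)
    fix b and \<gamma> :: "('a, 'd) config set"
    assume "b \<in> {b. {u \<in> patterns n. b u} \<in> (emptiness_event n :: ('a, 'd) config set set)}"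
      and "\<gamma> \<in> small_orbits (n div 2)" and "\<forall>u\<in>orbit_windows n \<gamma>. b u"
    then show False
      using orbit_windows_subset_imp_nonempty[of \<gamma> n "{u \<in> patterns n. b u}"] orbit_windows_patterns[of n \<gamma>]
      by (auto simp: emptiness_event_def small_orbits_def finite_orbits_def)
  qed
  then show ?thesis
    unfolding prob_random_patterns prob_no_small_orbit[OF \<alpha>, symmetric]
    by (intro measure_pmf.finite_measure_mono) auto
qed

text \<open>If \<omega> contains no small orbit but admits a point, the restriction of that point to
  the box is a pattern with more than n/2 distinct windows, all in \<omega>. The sum is the union
  bound over these patterns, each having probability \<open>\<alpha> ^ j\<close>.\<close>

lemma small_orbit_prod_le_prob_empty:
  fixes n K :: nat and \<alpha> :: real
  defines "m \<equiv> 2 * K * (n div 2)"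
  assumes \<alpha>: "0 \<le> \<alpha>" "\<alpha> \<le> 1" and n: "2 \<le> n" and K: "4 \<le> K"
  shows "small_orbit_prod TYPE(('a, 'd) config) \<alpha> (n div 2)
    \<le> measure_pmf.prob (random_patterns n \<alpha>) (emptiness_event n :: ('a::finite, 'd::finite) config set set)
      + (\<Sum>j | n \<le> 2 * j \<and> j \<le> m ^ CARD('d).
          card (patterns_with_windows n m j :: ('a, 'd) config set) * \<alpha> ^ j)"
proof -
  define Q where "Q = Pi_pmf (patterns n :: ('a, 'd) config set) False (\<lambda>_. bernoulli_pmf \<alpha>)"
  define E where "E = {b. {u \<in> patterns n. b u} \<in> (emptiness_event n :: ('a, 'd) config set set)}"
  define J where "J = {j. n \<le> 2 * j \<and> j \<le> m ^ CARD('d)}"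
  have finJ: "finite J" unfolding J_def by simp
  define B where "B = (\<lambda>u :: ('a, 'd) config. {b. \<forall>w \<in> window n u ` grid m. b w})"
  define \<U> where "\<U> = (\<lambda>j. patterns_with_windows n m j :: ('a, 'd) config set)"
  have fin\<U>: "finite (\<U> j)" for j
    unfolding \<U>_def by (rule finite_subset[OF _ finite_patterns[of "m + n - 1"]]) (auto simp: patterns_with_windows_def)
  have m: "2 * n \<le> m"
  proof -
    have "2 * n \<le> 8 * (n div 2)" using n by linarith
    also have "\<dots> \<le> m" unfolding m_def using K by (intro mult_le_mono1) simp
    finally show ?thesis .
  qed
  have sub: "{b. \<forall>\<gamma>\<in>small_orbits (n div 2). \<not> (\<forall>u\<in>orbit_windows n \<gamma> :: ('a, 'd) config set. b u)}
      \<subseteq> E \<union> (\<Union>j\<in>J. \<Union>u\<in>\<U> j. B u)"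
  proof
    fix b assume b: "b \<in> {b. \<forall>\<gamma>\<in>small_orbits (n div 2). \<not> (\<forall>u\<in>(orbit_windows n \<gamma> :: ('a, 'd) config set). b u)}"
    show "b \<in> E \<union> (\<Union>j\<in>J. \<Union>u\<in>\<U> j. B u)"
    proof (cases "subshift n {u \<in> patterns n. b u} = {}")
      case True
      then have "b \<in> E" by (auto simp: E_def emptiness_event_def)
      then show ?thesis by blast
    next
      case False
      then obtain x where x: "\<And>p. b (window n x p)" by (auto simp: subshift_window)
      define j where "j = card (window n x ` grid m)"
      define u where "u = restrict x (cube (m + n - 1))"
      have "window n u p = window n x p" if "p \<in> grid m" for p
        using grid_plus_cube[OF that] by (auto simp: window_eq_iff u_def)
      then have img: "window n u ` grid m = window n x ` grid m" by (intro image_cong) auto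
      have "\<not> j \<le> n div 2"
      proof
        assume j: "j \<le> n div 2"
        then have "card (window n x ` grid m) \<le> n" by (simp add: j_def)
        then obtain \<gamma> where \<gamma>: "finite_orbit \<gamma>" "card \<gamma> \<le> j" "orbit_windows n \<gamma> \<subseteq> window n x ` grid m"
          using few_windows_imp_finite_orbit[of n m x] n m by (auto simp: j_def orbit_windows_def)
        have "\<gamma> \<in> small_orbits (n div 2)" using \<gamma> j by (simp add: small_orbits_def finite_orbits_def)
        moreover have "\<forall>u\<in>orbit_windows n \<gamma>. b u" using \<gamma>(3) x by auto
        ultimately show False using b by blast
      qed
      moreover have "j \<le> m ^ CARD('d)"
        unfolding j_def card_grid[symmetric, where 'd = 'd] by (rule card_image_le[OF finite_grid])
      ultimately have "j \<in> J" by (auto simp: J_def)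
      moreover have "u \<in> \<U> j"
        by (simp add: \<U>_def patterns_with_windows_def img j_def) (simp add: u_def patterns_def)
      moreover have "b \<in> B u" unfolding B_def img using x by blast
      ultimately show ?thesis by blast
    qed
  qed
  have PB: "measure_pmf.prob Q (B u) = \<alpha> ^ j" if "u \<in> \<U> j" for u j
  proof -
    have "window n u ` grid m \<subseteq> patterns n" using window_in_patterns by blast
    from prob_all_Pi_pmf[OF finite_patterns this \<alpha>] show ?thesis
      using that by (simp add: Q_def B_def \<U>_def patterns_with_windows_def)
  qed
  have "small_orbit_prod TYPE(('a, 'd) config) \<alpha> (n div 2)
      \<le> measure_pmf.prob Q (E \<union> (\<Union>j\<in>J. \<Union>u\<in>\<U> j. B u))"
    unfolding prob_no_small_orbit[OF \<alpha>, symmetric] Q_def[symmetric]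
    using sub by (intro measure_pmf.finite_measure_mono) auto
  also have "\<dots> \<le> measure_pmf.prob Q E + measure_pmf.prob Q (\<Union>j\<in>J. \<Union>u\<in>\<U> j. B u)"
    by (rule measure_Un_le) auto
  also have "measure_pmf.prob Q (\<Union>j\<in>J. \<Union>u\<in>\<U> j. B u) \<le> (\<Sum>j\<in>J. measure_pmf.prob Q (\<Union>u\<in>\<U> j. B u))"
    by (rule measure_pmf.finite_measure_subadditive_finite[OF finJ]) auto
  also have "\<dots> \<le> (\<Sum>j\<in>J. \<Sum>u\<in>\<U> j. measure_pmf.prob Q (B u))"
    by (intro sum_mono measure_pmf.finite_measure_subadditive_finite fin\<U>) auto
  also have "\<dots> = (\<Sum>j\<in>J. card (\<U> j) * \<alpha> ^ j)"
    by (intro sum.cong refl) (simp add: PB)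
  finally show ?thesis
    unfolding prob_random_patterns by (simp add: Q_def E_def J_def \<U>_def)
qed

section \<open>Counting finite orbits\<close>

text \<open>By the pigeonhole principle each axis has a period of at most the size of the orbit, and
  shifts reduce modulo these periods.\<close>

lemma finite_orbit_eq_grid_shifts:
  assumes \<gamma>: "finite_orbit \<gamma>" and x: "x \<in> \<gamma>" and m: "card \<gamma> \<le> m"
  shows "\<gamma> = (\<lambda>p. shift p x) ` grid m"
proof
  show "(\<lambda>p. shift p x) ` grid m \<subseteq> \<gamma>" using finite_orbit_shift[OF \<gamma> x] by blast
  show "\<gamma> \<subseteq> (\<lambda>p. shift p x) ` grid m"
  proof
    fix y assume "y \<in> \<gamma>"
    then obtain p where p: "y = shift p x" using \<gamma> x unfolding finite_orbit_def by blast
    have fin: "finite \<gamma>" using \<gamma> by (simp add: finite_orbit_def)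
    have "\<exists>t. 0 < t \<and> t \<le> int (card \<gamma>) \<and> shift (axis i t) x = x" for i
    proof -
      let ?f = "\<lambda>a::nat. shift (axis i (int a)) x"
      have "?f ` {..card \<gamma>} \<subseteq> \<gamma>" using finite_orbit_shift[OF \<gamma> x] by blast
      then have "card (?f ` {..card \<gamma>}) \<le> card \<gamma>" using fin card_mono by blast
      then have "\<not> inj_on ?f {..card \<gamma>}" using card_image by fastforce
      then obtain a b where ab: "a < b" "b \<le> card \<gamma>" "?f a = ?f b"
        unfolding inj_on_def by (metis atMost_iff linorder_neqE_nat)
      have "axis i (int b) = axis i (int a) + axis i (int b - int a)"
        by (simp add: vec_eq_iff axis_def)
      then have "shift (- axis i (int a)) (?f b) = shift (axis i (int b - int a)) x"
        by (simp add: shift_add)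
      moreover have "shift (- axis i (int a)) (?f a) = x" by (simp add: shift_add)
      ultimately show ?thesis using ab by (intro exI[of _ "int b - int a"]) auto
    qed
    then obtain t where t: "\<And>i. 0 < t i" "\<And>i. t i \<le> int (card \<gamma>)" "\<And>i. shift (axis i (t i)) x = x"
      by metis
    define F where "F = int (fact (card \<gamma>))"
    \<comment> \<open>A multiple of the period \<open>F\<close> makes the shift vector nonnegative,
      as \<open>mod_periodic\<close> works from 0 upwards.\<close>
    define v where "v = p + F *s (\<chi> i. \<bar>p $ i\<bar>)"
    have "1 \<le> F" using fact_ge_1[of "card \<gamma>", where 'a = nat] unfolding F_def by linarith
    then have "1 * \<bar>p $ i\<bar> \<le> F * \<bar>p $ i\<bar>" for i by (rule mult_right_mono) simp
    moreover have "v $ i = p $ i + F * \<bar>p $ i\<bar>" for i by (simp add: v_def)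
    ultimately have v0: "0 \<le> v $ i" for i by (smt (verit))
    have "y = shift v x"
      unfolding v_def F_def p shift_add[symmetric] finite_orbit_fact_period[OF \<gamma> x] ..
    also have "\<dots> = shift (\<chi> i. v $ i mod t i) x"
      by (rule mod_periodic[where x = "\<lambda>q. shift q x" and u = "\<lambda>i. v $ i + 1", OF t(1)])
        (use v0 in \<open>simp_all add: t(3) flip: shift_add\<close>)
    finally have "y = shift (\<chi> i. v $ i mod t i) x" .
    moreover have "(\<chi> i. v $ i mod t i) \<in> grid m"
    proof -
      have "0 \<le> v $ i mod t i \<and> v $ i mod t i < int m" for i
        using pos_mod_bound[OF t(1), of "v $ i" i] pos_mod_sign[OF t(1), of "v $ i" i] t(2)[of i] m by linarith
      then show ?thesis by (simp add: grid_def)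
    qed
    ultimately show "y \<in> (\<lambda>p. shift p x) ` grid m" by blast
  qed
qed

definition orbits_of_card :: "nat \<Rightarrow> ('a, 'd::finite) config set set" where
  "orbits_of_card k = {\<gamma> \<in> finite_orbits UNIV. card \<gamma> = k}"

lemma finite_orbits_of_card: "finite (orbits_of_card k :: ('a::finite, 'd::finite) config set set)"
  unfolding orbits_of_card_def by (rule finite_finite_orbits_card)

text \<open>A point of the orbit, cut down to the box, shows all \<open>k\<close> windows of the
  orbit, and its window at 0 identifies the point. For window side n = 2k the box side is
  \<open>2 * K * (n div 2)\<close>, so the asymptotic pattern count also bounds the number of
  orbits.\<close>

lemma card_orbits_of_card_le:
  assumes K: "1 \<le> K"
  shows "card (orbits_of_card k :: ('a::finite, 'd::finite) config set set)
    \<le> card (patterns_with_windows (2 * k) (2 * K * k) k :: ('a, 'd) config set)"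
proof -
  define m where "m = 2 * K * k"
  have mk: "k \<le> m" using K unfolding m_def by (simp add: mult.assoc)
  define pt where "pt = (\<lambda>\<gamma> :: ('a, 'd) config set. SOME x. x \<in> \<gamma>)"
  define f where "f = (\<lambda>\<gamma> :: ('a, 'd) config set. restrict (pt \<gamma>) (cube (m + 2 * k - 1)))"
  have orb: "finite_orbit \<gamma>" "card \<gamma> = k" "0 < k" "pt \<gamma> \<in> \<gamma>" if "\<gamma> \<in> orbits_of_card k" for \<gamma>
  proof -
    show o: "finite_orbit \<gamma>" "card \<gamma> = k" using that by (auto simp: orbits_of_card_def finite_orbits_def)
    show "0 < k" using card_finite_orbit_pos[OF o(1)] o(2) by simp
    show "pt \<gamma> \<in> \<gamma>" using o(1) by (simp add: pt_def some_in_eq finite_orbit_def)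
  qed
  have win: "window (2 * k) (f \<gamma>) p = restrict (shift p (pt \<gamma>)) (cube (2 * k))"
    if "p \<in> grid m" for p and \<gamma> :: "('a, 'd) config set"
    using grid_plus_cube[OF that] by (auto simp: window_def restrict_eq_iff f_def shift_apply)
  show ?thesis unfolding m_def[symmetric]
  proof (rule card_inj_on_le[where f = f])
    show "f ` orbits_of_card k \<subseteq> patterns_with_windows (2 * k) m k"
    proof (rule image_subsetI)
      fix \<gamma> :: "('a, 'd) config set" assume g: "\<gamma> \<in> orbits_of_card k"
      have "window (2 * k) (f \<gamma>) ` grid m = (\<lambda>y. restrict y (cube (2 * k))) ` (\<lambda>p. shift p (pt \<gamma>)) ` grid m"
        unfolding image_image by (intro image_cong refl win)
      also have "(\<lambda>p. shift p (pt \<gamma>)) ` grid m = \<gamma>"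
        using finite_orbit_eq_grid_shifts[OF orb(1)[OF g] orb(4)[OF g], of m] orb(2)[OF g] mk by simp
      finally have "window (2 * k) (f \<gamma>) ` grid m = orbit_windows (2 * k) \<gamma>"
        by (simp only: orbit_windows_def)
      then have "card (window (2 * k) (f \<gamma>) ` grid m) = k"
        using card_orbit_windows[OF orb(1)[OF g], of "2 * k"] orb(2)[OF g] by simp
      then show "f \<gamma> \<in> patterns_with_windows (2 * k) m k"
        by (simp add: patterns_with_windows_def) (simp add: f_def patterns_def)
    qed
    show "inj_on f (orbits_of_card k)"
    proof (rule inj_onI)
      fix \<gamma> \<delta> :: "('a, 'd) config set"
      assume g: "\<gamma> \<in> orbits_of_card k" and d: "\<delta> \<in> orbits_of_card k" and eq: "f \<gamma> = f \<delta>"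
      have "0 < m" using mk orb(3)[OF g] by simp
      then have "0 \<in> (grid m :: (int ^ 'd) set)" by (simp add: grid_def)
      from win[OF this, of \<gamma>] win[OF this, of \<delta>]
      have "restrict (pt \<gamma>) (cube (2 * k)) = restrict (pt \<delta>) (cube (2 * k))" using eq by simp
      then have "pt \<gamma> = pt \<delta>"
        using finite_orbit_union_inj'[OF orb(1)[OF g] orb(1)[OF d], of "2 * k"]
          orb(2,4)[OF g] orb(2,4)[OF d] by (auto simp: inj_on_def)
      then show "\<gamma> = \<delta>" using finite_orbit_disjoint[OF orb(1)[OF g] orb(1)[OF d]] orb(4)[OF g] orb(4)[OF d] by auto
    qed
    show "finite (patterns_with_windows (2 * k) m k :: ('a, 'd) config set)"
      by (rule finite_subset[OF _ finite_patterns[of "m + 2 * k - 1"]]) (auto simp: patterns_with_windows_def)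
  qed
qed

section \<open>Lower bound on the number of orbits from one-dimensional periodic words\<close>

lemma periodic_int_mod:
  fixes h :: "int \<Rightarrow> 'b"
  assumes "\<And>z. h (z + k) = h z"
  shows "h (z mod k) = h z"
proof -
  have pos: "h (z + int c * k) = h z" for c z
  proof (induction c)
    case (Suc c)
    have "h (z + int (Suc c) * k) = h ((z + int c * k) + k)" by (simp add: algebra_simps)
    then show ?case using assms Suc by metis
  qed simp
  have "h (z + c * k) = h z" for c z
  proof (cases "0 \<le> c")
    case True
    then show ?thesis using pos[of z "nat c"] by simp
  next
    case False
    then show ?thesis using pos[of "z + c * k" "nat (- c)"] by simp
  qed
  from this[of z "- (z div k)"] show ?thesis by (simp add: minus_div_mult_eq_mod)
qed

text \<open>Periodic words of length \<open>k\<close> written along axis \<open>i\<close> and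
  constant in all other directions.\<close>

definition axis_periodic :: "'d \<Rightarrow> nat \<Rightarrow> ('a, 'd::finite) config set" where
  "axis_periodic i k =
     {x. (\<forall>p. shift p x = shift (axis i (p $ i)) x) \<and> shift (axis i (int k)) x = x}"

lemma axis_add: "axis i (a + b) = axis i a + (axis i b :: int ^ 'd::finite)"
  by (simp add: vec_eq_iff axis_def)

lemma axis_periodic_shift:
  assumes "x \<in> axis_periodic i k"
  shows "shift p x = shift (axis i (p $ i mod int k)) x"
proof -
  have "shift (axis i (z + int k)) x = shift (axis i z) x" for z
    using assms by (simp add: axis_periodic_def axis_add flip: shift_add)
  from periodic_int_mod[of "\<lambda>z. shift (axis i z) x", OF this] show ?thesis
    using assms by (auto simp: axis_periodic_def)
qed

lemma card_axis_periodic: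
  fixes i :: "'d::finite"
  assumes k: "0 < k"
  shows "finite (axis_periodic i k :: ('a::finite, 'd) config set)"
    "card (axis_periodic i k :: ('a, 'd) config set) = CARD('a) ^ k"
proof -
  let ?W = "{..<k} \<rightarrow>\<^sub>E (UNIV :: 'a set)"
  let ?f = "\<lambda>x :: ('a, 'd) config. \<lambda>a\<in>{..<k}. x (axis i (int a))"
  let ?g = "\<lambda>(w :: nat \<Rightarrow> 'a) (q :: int ^ 'd). w (nat (q $ i mod int k))"
  have bij: "bij_betw ?f (axis_periodic i k) ?W"
  proof (rule bij_betwI[where g = ?g])
    show "?g \<in> ?W \<rightarrow> axis_periodic i k"
      by (auto simp: axis_periodic_def shift_def fun_eq_iff)
    fix x :: "('a, 'd) config" assume x: "x \<in> axis_periodic i k"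
    show "?g (?f x) = x"
    proof
      fix q :: "int ^ 'd"
      have "nat (q $ i mod int k) < k" using k by (simp add: nat_less_iff)
      moreover have "x q = x (axis i (q $ i mod int k))"
        using fun_cong[OF axis_periodic_shift[OF x, of q], of 0] by (simp add: shift_apply)
      ultimately show "?g (?f x) q = x q" using k by simp
    qed
  next
    fix w assume "w \<in> ?W"
    then show "?f (?g w) = w"
      by (intro ext) (auto simp: axis_def PiE_def extensional_def)
  qed auto
  have fin: "finite ?W" by (intro finite_PiE) auto
  then show "finite (axis_periodic i k :: ('a, 'd) config set)" using bij bij_betw_finite by blast
  show "card (axis_periodic i k :: ('a, 'd) config set) = CARD('a) ^ k"
    using bij_betw_same_card[OF bij] by (simp add: card_PiE)
qed

text \<open>If two of the first \<open>k\<close> shifts coincide, the least period is below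
  \<open>k\<close>. It divides \<open>k\<close>, since \<open>k mod t\<close> would otherwise be a
  smaller period, and so is at most \<open>k div 2\<close>.\<close>

lemma axis_periodic_orbit:
  fixes i :: "'d::finite" and x :: "('a::finite, 'd) config"
  assumes x: "x \<in> axis_periodic i k" and k: "0 < k"
  shows "finite_orbit (range (\<lambda>p. shift p x))"
    "card (range (\<lambda>p. shift p x)) = k \<or> (\<exists>t. 0 < t \<and> t \<le> k div 2 \<and> x \<in> axis_periodic i t)"
proof -
  let ?f = "\<lambda>a::nat. shift (axis i (int a)) x"
  have range: "range (\<lambda>p. shift p x) = ?f ` {..<k}"
  proof
    show "range (\<lambda>p. shift p x) \<subseteq> ?f ` {..<k}"
    proof (rule image_subsetI)
      fix p :: "int ^ 'd"
      have "shift p x = ?f (nat (p $ i mod int k))" using axis_periodic_shift[OF x] k by simp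
      moreover have "nat (p $ i mod int k) < k" using k by (simp add: nat_less_iff)
      ultimately show "shift p x \<in> ?f ` {..<k}" by blast
    qed
  qed auto
  then show "finite_orbit (range (\<lambda>p. shift p x))" by (intro finite_orbit_range) simp
  show "card (range (\<lambda>p. shift p x)) = k \<or> (\<exists>t. 0 < t \<and> t \<le> k div 2 \<and> x \<in> axis_periodic i t)"
  proof (cases "inj_on ?f {..<k}")
    case True
    then show ?thesis unfolding range by (simp add: card_image)
  next
    case False
    then obtain a b where ab: "a < b" "b < k" "?f a = ?f b"
      unfolding inj_on_def by (metis lessThan_iff linorder_neqE_nat)
    define per where "per = (\<lambda>t::nat. 0 < t \<and> shift (axis i (int t)) x = x)"
    have "axis i (int (b - a)) = - axis i (int a) + axis i (int b)"
      using ab by (simp add: vec_eq_iff axis_def of_nat_diff)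
    then have "shift (- axis i (int a)) (?f b) = shift (axis i (int (b - a))) x"
      by (simp add: shift_add)
    moreover have "shift (- axis i (int a)) (?f a) = x" by (simp add: shift_add)
    ultimately have per_ab: "per (b - a)" using ab by (simp add: per_def)
    define t where "t = (LEAST t. per t)"
    have t: "per t" "t \<le> b - a" unfolding t_def using per_ab by (auto intro: LeastI Least_le)
    have "shift (axis i (z + int t)) x = shift (axis i z) x" for z
      using t(1) by (simp add: per_def axis_add flip: shift_add)
    from periodic_int_mod[of "\<lambda>z. shift (axis i z) x", OF this, of "int k"]
    have "shift (axis i (int (k mod t))) x = x"
      using x by (simp add: axis_periodic_def zmod_int)
    then have "per (k mod t) \<or> k mod t = 0" unfolding per_def by blast
    moreover have "k mod t < t" using t(1) by (simp add: per_def)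
    then have "\<not> per (k mod t)" unfolding t_def by (rule not_less_Least)
    ultimately have "k mod t = 0" by blast
    then obtain c where c: "k = t * c" by blast
    have "c \<noteq> 0" "c \<noteq> 1" using c k t ab by auto
    then have "t * 2 \<le> k" unfolding c by (intro mult_le_mono2) linarith
    then have "t \<le> k div 2" by linarith
    moreover have "x \<in> axis_periodic i t" using x t(1) by (simp add: axis_periodic_def per_def)
    ultimately show ?thesis using t(1) by (auto simp: per_def)
  qed
qed

lemma sum_powers_le:
  fixes N :: nat
  assumes "2 \<le> N"
  shows "(\<Sum>t=1..a. N ^ t) \<le> 2 * N ^ a"
proof (induction a)
  case (Suc a)
  have "2 * N ^ a \<le> N * N ^ a" using assms by (rule mult_le_mono1)
  moreover have "(\<Sum>t=1..Suc a. N ^ t) = (\<Sum>t=1..a. N ^ t) + N * N ^ a" by simp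
  ultimately show ?case using Suc unfolding power_Suc by linarith
qed simp

text \<open>Words with a period of at most k/2 number at most 2 |A|^(k/2), which is at most half of
  |A|^k once \<open>k \<ge> 4\<close>. The others have orbits of size \<open>k\<close>, and one
  orbit contains at most \<open>k\<close> of them.\<close>

lemma card_orbits_of_card_ge:
  assumes N: "2 \<le> CARD('a)" and k: "4 \<le> k"
  shows "CARD('a) ^ k \<le> 2 * k * card (orbits_of_card k :: ('a::finite, 'd::finite) config set set)"
proof -
  fix i :: 'd
  let ?N = "CARD('a)"
  let ?Y = "axis_periodic i :: nat \<Rightarrow> ('a, 'd) config set"
  define orb where "orb = (\<lambda>x :: ('a, 'd) config. range (\<lambda>p. shift p x))"
  define G where "G = {x \<in> ?Y k. card (orb x) = k}"
  have finG: "finite G" using card_axis_periodic(1)[of k i] k by (auto simp: G_def)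
  have "card (?Y k) \<le> card (G \<union> (\<Union>t\<in>{1..k div 2}. ?Y t))"
  proof (rule card_mono)
    show "finite (G \<union> (\<Union>t\<in>{1..k div 2}. ?Y t))" 
      using finG by (intro finite_UnI finite_UN_I card_axis_periodic(1)) auto
    show "?Y k \<subseteq> G \<union> (\<Union>t\<in>{1..k div 2}. ?Y t)"
      using axis_periodic_orbit(2)[of _ i k] k by (fastforce simp: G_def orb_def)
  qed
  also have "\<dots> \<le> card G + card (\<Union>t\<in>{1..k div 2}. ?Y t)" by (rule card_Un_le)
  also have "card (\<Union>t\<in>{1..k div 2}. ?Y t) \<le> (\<Sum>t=1..k div 2. card (?Y t))"
    by (rule card_UN_le) simp
  also have "\<dots> = (\<Sum>t=1..k div 2. ?N ^ t)" by (intro sum.cong refl card_axis_periodic(2)) simp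
  also have "\<dots> \<le> 2 * ?N ^ (k div 2)" by (rule sum_powers_le[OF N])
  finally have A: "?N ^ k \<le> card G + 2 * ?N ^ (k div 2)" using card_axis_periodic(2)[of k i, where 'a = 'a] k by simp
  have "2 * 2 * ?N ^ (k div 2) \<le> ?N * ?N * ?N ^ (k div 2)"
    using N by (intro mult_le_mono1 mult_le_mono)
  also have "\<dots> = ?N ^ (k div 2 + 2)" by (simp add: power2_eq_square power_add)
  also have "\<dots> \<le> ?N ^ k" using k N by (intro power_increasing) auto
  finally have B: "?N ^ k \<le> 2 * card G" using A by linarith
  have "card G \<le> card (\<Union>\<gamma>\<in>orbits_of_card k. \<gamma> :: ('a, 'd) config set)"
  proof (rule card_mono)
    show "finite (\<Union>\<gamma>\<in>orbits_of_card k. \<gamma> :: ('a, 'd) config set)"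
      using finite_orbits_of_card[of k] by (auto simp: orbits_of_card_def finite_orbits_def finite_orbit_def)
    show "G \<subseteq> (\<Union>\<gamma>\<in>orbits_of_card k. \<gamma>)"
    proof
      fix x assume x: "x \<in> G"
      then have "orb x \<in> orbits_of_card k"
        using axis_periodic_orbit(1)[of x i k] k
        by (auto simp: G_def orbits_of_card_def finite_orbits_def orb_def)
      moreover have "x \<in> orb x" unfolding orb_def using shift_0 by (metis rangeI)
      ultimately show "x \<in> (\<Union>\<gamma>\<in>orbits_of_card k. \<gamma>)" by blast
    qed
  qed
  also have "\<dots> \<le> (\<Sum>\<gamma>\<in>orbits_of_card k. card (\<gamma> :: ('a, 'd) config set))"
    by (rule card_UN_le[OF finite_orbits_of_card])
  also have "\<dots> = card (orbits_of_card k :: ('a, 'd) config set set) * k"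
    by (simp add: orbits_of_card_def)
  finally show ?thesis using B by (simp add: mult_ac)
qed

section \<open>The zeta function\<close>

lemma one_minus_sum_le_prod:
  fixes f :: "'b \<Rightarrow> real"
  assumes "finite A" "\<And>a. a \<in> A \<Longrightarrow> 0 \<le> f a \<and> f a \<le> 1"
  shows "1 - sum f A \<le> (\<Prod>a\<in>A. 1 - f a)"
  using assms
proof (induction A rule: finite_induct)
  case (insert x A)
  have f: "0 \<le> f x" "f x \<le> 1" "0 \<le> sum f A" using insert.prems by (auto intro: sum_nonneg)
  have "1 - sum f (insert x A) \<le> (1 - f x) * (1 - sum f A)"
    using f insert.hyps by (simp add: algebra_simps)
  also have "\<dots> \<le> (1 - f x) * (\<Prod>a\<in>A. 1 - f a)"
    using f insert by (intro mult_left_mono) auto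
  finally show ?case using insert.hyps by simp
qed simp

lemma sum_power_tail_le:
  fixes \<theta> :: real
  assumes \<theta>: "0 \<le> \<theta>" "\<theta> < 1" and J: "finite J" "\<And>j. j \<in> J \<Longrightarrow> a \<le> j"
  shows "(\<Sum>j\<in>J. \<theta> ^ j) \<le> \<theta> ^ a / (1 - \<theta>)"
proof -
  have "(\<Sum>j\<in>J. \<theta> ^ j) = (\<Sum>i\<in>(\<lambda>j. j - a) ` J. \<theta> ^ (a + i))"
    using J(2) by (subst sum.reindex) (auto intro!: inj_on_diff_nat sum.cong)
  also have "\<dots> = \<theta> ^ a * (\<Sum>i\<in>(\<lambda>j. j - a) ` J. \<theta> ^ i)"
    by (simp add: power_add sum_distrib_left)
  also have "\<dots> \<le> \<theta> ^ a * (\<Sum>i. \<theta> ^ i)"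
    using \<theta> J(1) by (intro mult_left_mono sum_le_suminf summable_geometric) auto
  also have "\<dots> = \<theta> ^ a / (1 - \<theta>)" using \<theta> by (simp add: suminf_geometric)
  finally show ?thesis .
qed

text \<open>One rate serves both tails, since patterns with \<open>j\<close> windows and orbits of
  size \<open>j\<close> obey the same bound \<open>\<mu> ^ j\<close>.\<close>

lemma subcritical_bounds:
  fixes \<alpha> :: real
  assumes \<alpha>: "0 \<le> \<alpha>" "\<alpha> < inverse (real CARD('a::finite))"
  shows "\<exists>\<theta>. 0 < \<theta> \<and> \<theta> < 1 \<and>
    (\<forall>\<^sub>F n in sequentially.
      \<bar>measure_pmf.prob (random_patterns n \<alpha>) (emptiness_event n :: ('a, 'd::finite) config set set)
        - small_orbit_prod TYPE(('a, 'd) config) \<alpha> (n div 2)\<bar> \<le> \<theta> ^ (n div 2) / (1 - \<theta>)) \<and>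
    (\<forall>\<^sub>F k in sequentially. \<forall>\<Gamma>. finite \<Gamma> \<longrightarrow>
      \<Gamma> \<subseteq> finite_orbits (UNIV :: ('a, 'd) config set) - small_orbits k \<longrightarrow>
      (\<Sum>\<gamma>\<in>\<Gamma>. \<alpha> ^ card \<gamma>) \<le> \<theta> ^ k / (1 - \<theta>))"
proof -
  obtain K :: nat and \<eta> :: real where K: "4 \<le> K" and \<eta>: "1 < \<eta>"
    and lt1: "\<alpha> * (\<eta> * real CARD('a) powr ((1 + 1 / real K) ^ CARD('d))) < 1"
    using exists_growth_rate[OF \<alpha>] by blast
  define \<mu> where "\<mu> = \<eta> * real CARD('a) powr ((1 + 1 / real K) ^ CARD('d))"
  have \<mu>: "0 \<le> \<mu>" using \<eta> by (simp add: \<mu>_def)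
  \<comment> \<open>The maximum with 1/2 keeps \<theta> positive when \<alpha> = 0.\<close>
  define \<theta> where "\<theta> = max (\<alpha> * \<mu>) (1 / 2)"
  have \<theta>: "0 < \<theta>" "\<theta> < 1" "\<alpha> * \<mu> \<le> \<theta>" using lt1 by (auto simp: \<theta>_def \<mu>_def)
  have "inverse (real CARD('a)) \<le> 1" by (simp add: inverse_le_1_iff Suc_le_eq)
  then have \<alpha>1: "\<alpha> \<le> 1" using \<alpha>(2) by linarith
  let ?U = "\<lambda>n j. patterns_with_windows n (2 * K * (n div 2)) j :: ('a, 'd) config set"
  have "\<forall>\<^sub>F n in sequentially. \<forall>j. n \<le> 2 * j \<longrightarrow> real (card (?U n j)) \<le> \<mu> ^ j"
    unfolding \<mu>_def using \<eta> K by (intro patterns_with_windows_asymptotic) auto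
  then obtain n0 where n0: "\<And>n j. n0 \<le> n \<Longrightarrow> n \<le> 2 * j \<Longrightarrow> real (card (?U n j)) \<le> \<mu> ^ j"
    unfolding eventually_sequentially by blast
  have growth: "real (card (?U n j)) * \<alpha> ^ j \<le> \<theta> ^ j" if "n0 \<le> n" "n \<le> 2 * j" for n j
  proof -
    have "real (card (?U n j)) * \<alpha> ^ j \<le> \<mu> ^ j * \<alpha> ^ j"
      using n0[OF that] \<alpha> by (intro mult_right_mono) auto
    also have "\<dots> = (\<alpha> * \<mu>) ^ j" by (simp add: power_mult_distrib mult.commute)
    also have "\<dots> \<le> \<theta> ^ j" using \<theta> \<alpha> \<mu> by (intro power_mono) auto
    finally show ?thesis .
  qed
  have "\<forall>\<^sub>F n in sequentially. max n0 2 \<le> n" by (rule eventually_ge_at_top)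
  then have 1: "\<forall>\<^sub>F n in sequentially.
      \<bar>measure_pmf.prob (random_patterns n \<alpha>) (emptiness_event n :: ('a, 'd) config set set)
        - small_orbit_prod TYPE(('a, 'd) config) \<alpha> (n div 2)\<bar> \<le> \<theta> ^ (n div 2) / (1 - \<theta>)"
  proof eventually_elim
    case (elim n)
    define J where "J = {j. n \<le> 2 * j \<and> j \<le> (2 * K * (n div 2)) ^ CARD('d)}"
    have "(\<Sum>j\<in>J. card (?U n j) * \<alpha> ^ j) \<le> (\<Sum>j\<in>J. \<theta> ^ j)"
      using elim growth by (intro sum_mono) (auto simp: J_def)
    also have "\<dots> \<le> \<theta> ^ (n div 2) / (1 - \<theta>)"
      using \<theta> by (intro sum_power_tail_le) (auto simp: J_def)
    finally have "(\<Sum>j\<in>J. card (?U n j) * \<alpha> ^ j) \<le> \<theta> ^ (n div 2) / (1 - \<theta>)" .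
    then show ?case
      using small_orbit_prod_le_prob_empty[OF \<alpha>(1) \<alpha>1 _ K, of n, where 'a = 'a and 'd = 'd]
        prob_empty_le_small_orbit_prod[OF \<alpha>(1) \<alpha>1, of n, where 'a = 'a and 'd = 'd] elim
      by (simp add: J_def abs_le_iff)
  qed
  have "\<forall>\<^sub>F k in sequentially. n0 \<le> k" by (rule eventually_ge_at_top)
  then have 2: "\<forall>\<^sub>F k in sequentially. \<forall>\<Gamma>. finite \<Gamma> \<longrightarrow>
      \<Gamma> \<subseteq> finite_orbits (UNIV :: ('a, 'd) config set) - small_orbits k \<longrightarrow>
      (\<Sum>\<gamma>\<in>\<Gamma>. \<alpha> ^ card \<gamma>) \<le> \<theta> ^ k / (1 - \<theta>)"
  proof eventually_elim
    case (elim k)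
    show ?case
    proof (intro allI impI)
      fix \<Gamma> assume fin: "finite \<Gamma>"
        and \<Gamma>: "\<Gamma> \<subseteq> finite_orbits (UNIV :: ('a, 'd) config set) - small_orbits k"
      have "(\<Sum>\<gamma>\<in>\<Gamma>. \<alpha> ^ card \<gamma>) = (\<Sum>j\<in>card ` \<Gamma>. \<Sum>\<gamma> | \<gamma> \<in> \<Gamma> \<and> card \<gamma> = j. \<alpha> ^ card \<gamma>)"
        by (rule sum.image_gen[OF fin])
      also have "\<dots> \<le> (\<Sum>j\<in>card ` \<Gamma>. \<theta> ^ j)"
      proof (rule sum_mono)
        fix j assume "j \<in> card ` \<Gamma>"
        then have kj: "k \<le> j" using \<Gamma> by (auto simp: small_orbits_def)
        have "(\<Sum>\<gamma> | \<gamma> \<in> \<Gamma> \<and> card \<gamma> = j. \<alpha> ^ card \<gamma>) = card {\<gamma> \<in> \<Gamma>. card \<gamma> = j} * \<alpha> ^ j" by simp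
        also have "\<dots> \<le> card (?U (2 * j) j) * \<alpha> ^ j"
        proof -
          have "card {\<gamma> \<in> \<Gamma>. card \<gamma> = j} \<le> card (orbits_of_card j :: ('a, 'd) config set set)"
            using \<Gamma> by (intro card_mono finite_orbits_of_card) (auto simp: orbits_of_card_def)
          also have "\<dots> \<le> card (?U (2 * j) j)" using card_orbits_of_card_le[of K j] K by simp
          finally show ?thesis using \<alpha> by (intro mult_right_mono) auto
        qed
        also have "\<dots> \<le> \<theta> ^ j" using elim kj by (intro growth) auto
        finally show "(\<Sum>\<gamma> | \<gamma> \<in> \<Gamma> \<and> card \<gamma> = j. \<alpha> ^ card \<gamma>) \<le> \<theta> ^ j" .
      qed
      also have "\<dots> \<le> \<theta> ^ k / (1 - \<theta>)"
        using \<theta> fin \<Gamma> by (intro sum_power_tail_le) (auto simp: small_orbits_def)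
      finally show "(\<Sum>\<gamma>\<in>\<Gamma>. \<alpha> ^ card \<gamma>) \<le> \<theta> ^ k / (1 - \<theta>)" .
    qed
  qed
  from \<theta> 1 2 show ?thesis by blast
qed

text \<open>The tail bound first makes the sum over all orbits finite, so that the infinite product
  converges and can be inverted. The factors beyond the small orbits multiply to some
  \<open>r\<close> with \<open>1 - \<epsilon> k \<le> r \<le> 1\<close>.\<close>

lemma zeta_tail:
  fixes \<alpha> \<theta> :: real
  assumes \<alpha>: "0 \<le> \<alpha>" "\<alpha> < 1"
    and tail: "\<forall>\<^sub>F k in sequentially. \<forall>\<Gamma>. finite \<Gamma> \<longrightarrow>
      \<Gamma> \<subseteq> finite_orbits (UNIV :: ('a::finite, 'd::finite) config set) - small_orbits k \<longrightarrow>
      (\<Sum>\<gamma>\<in>\<Gamma>. \<alpha> ^ card \<gamma>) \<le> \<epsilon> k"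
  shows "\<forall>\<^sub>F k in sequentially.
    \<bar>inverse (zeta (UNIV :: ('a, 'd) config set) \<alpha>) - small_orbit_prod TYPE(('a, 'd) config) \<alpha> k\<bar> \<le> \<epsilon> k"
proof -
  define e where "e = orbit_enumeration (UNIV :: ('a, 'd) config set)"
  define I where "I = orbit_indices (UNIV :: ('a, 'd) config set)"
  have bij: "bij_betw e I (finite_orbits UNIV)"
    using orbit_enumeration[of "UNIV :: ('a, 'd) config set"] by (simp add: is_orbit_enumeration_def e_def I_def)
  have inj: "inj_on e I" and img: "e ` I = finite_orbits UNIV" using bij by (auto simp: bij_betw_def)
  have card_pos: "0 < card \<gamma>" if "\<gamma> \<in> finite_orbits UNIV" for \<gamma> :: "('a, 'd) config set"
    using that card_finite_orbit_pos by (auto simp: finite_orbits_def)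
  \<comment> \<open>The value 0 off the index set matches the factor 1 in
    \<open>zeta\<close>.\<close>
  define g where "g = (\<lambda>i. if i \<in> I then \<alpha> ^ card (e i) else 0)"
  have g: "0 \<le> g i" "g i < 1" for i
  proof -
    show "0 \<le> g i" using \<alpha> by (simp add: g_def)
    have "\<alpha> ^ card (e i) < 1" if "i \<in> I"
    proof -
      have "1 \<le> card (e i)" using that card_pos[of "e i"] img by (auto simp: Suc_le_eq)
      then have "\<alpha> ^ card (e i) \<le> \<alpha> ^ 1" using \<alpha> by (intro power_decreasing) auto
      then show ?thesis using \<alpha> by simp
    qed
    then show "g i < 1" by (simp add: g_def)
  qed
  define \<Gamma> where "\<Gamma> = (\<lambda>M. e ` (I \<inter> {..M}))"
  have fin\<Gamma>: "finite (\<Gamma> M)" for M by (simp add: \<Gamma>_def)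
  have \<Gamma>: "\<Gamma> M \<subseteq> finite_orbits UNIV" for M using img by (auto simp: \<Gamma>_def)
  have inj': "inj_on e (I \<inter> {..M})" for M using inj by (rule inj_on_subset) simp
  have sum_g: "sum g {..M} = (\<Sum>\<gamma>\<in>\<Gamma> M. \<alpha> ^ card \<gamma>)" for M
  proof -
    have "(\<Sum>\<gamma>\<in>\<Gamma> M. \<alpha> ^ card \<gamma>) = (\<Sum>i\<in>{..M} \<inter> I. \<alpha> ^ card (e i))"
      unfolding \<Gamma>_def sum.reindex[OF inj'] by (simp add: Int_commute)
    also have "\<dots> = sum g {..M}" unfolding g_def by (rule sum.inter_restrict) simp
    finally show ?thesis ..
  qed
  have prod_g: "(\<Prod>i\<le>M. 1 - g i) = (\<Prod>\<gamma>\<in>\<Gamma> M. 1 - \<alpha> ^ card \<gamma>)" for M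
  proof -
    have "(\<Prod>\<gamma>\<in>\<Gamma> M. 1 - \<alpha> ^ card \<gamma>) = (\<Prod>i\<in>{..M} \<inter> I. 1 - \<alpha> ^ card (e i))"
      unfolding \<Gamma>_def prod.reindex[OF inj'] by (simp add: Int_commute)
    also have "\<dots> = (\<Prod>i\<le>M. if i \<in> I then 1 - \<alpha> ^ card (e i) else 1)"
      by (rule prod.inter_restrict) simp
    also have "\<dots> = (\<Prod>i\<le>M. 1 - g i)" by (intro prod.cong) (auto simp: g_def)
    finally show ?thesis ..
  qed
  have nonneg: "0 \<le> \<alpha> ^ card \<gamma>" "\<alpha> ^ card \<gamma> \<le> 1" for \<gamma> :: "('a, 'd) config set"
    using \<alpha> by (auto intro: power_le_one)
  have summable: "summable g"
  proof -
    obtain k where k: "\<And>\<Gamma>. finite \<Gamma> \<Longrightarrow> \<Gamma> \<subseteq> finite_orbits (UNIV :: ('a, 'd) config set) - small_orbits k \<Longrightarrow>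
      (\<Sum>\<gamma>\<in>\<Gamma>. \<alpha> ^ card \<gamma>) \<le> \<epsilon> k"
      using eventually_happens'[OF sequentially_bot tail] by blast
    have "sum g {..M} \<le> (\<Sum>\<gamma>\<in>(small_orbits k :: ('a, 'd) config set set). \<alpha> ^ card \<gamma>) + \<epsilon> k" for M
    proof -
      have "sum g {..M} \<le> (\<Sum>\<gamma>\<in>small_orbits k \<union> (\<Gamma> M - small_orbits k). \<alpha> ^ card \<gamma>)"
        unfolding sum_g by (intro sum_mono2) (auto simp: finite_small_orbits fin\<Gamma> nonneg)
      also have "\<dots> = (\<Sum>\<gamma>\<in>(small_orbits k :: ('a, 'd) config set set). \<alpha> ^ card \<gamma>) + (\<Sum>\<gamma>\<in>\<Gamma> M - small_orbits k. \<alpha> ^ card \<gamma>)"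
        by (rule sum.union_disjoint) (auto simp: finite_small_orbits fin\<Gamma>)
      also have "(\<Sum>\<gamma>\<in>\<Gamma> M - small_orbits k. \<alpha> ^ card \<gamma>) \<le> \<epsilon> k"
        using \<Gamma>[of M] fin\<Gamma>[of M] by (intro k) auto
      finally show ?thesis by simp
    qed
    then show ?thesis using g(1) by (intro bounded_imp_summable)
  qed
  have conv: "convergent_prod (\<lambda>i. 1 - g i)"
    using summable_imp_convergent_prod_real[of "\<lambda>i. - g i"] summable g
    by (simp add: abs_of_nonneg less_le)
  have "zeta (UNIV :: ('a, 'd) config set) \<alpha> = (\<Prod>i. inverse (1 - g i))"
    unfolding zeta_def by (intro arg_cong[where f = prodinf]) (auto simp: g_def e_def I_def fun_eq_iff)
  also have "\<dots> = inverse (\<Prod>i. 1 - g i)" by (rule prodinf_inverse[OF conv])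
  finally have "inverse (zeta (UNIV :: ('a, 'd) config set) \<alpha>) = (\<Prod>i. 1 - g i)" by simp
  then have lim: "(\<lambda>M. \<Prod>\<gamma>\<in>\<Gamma> M. 1 - \<alpha> ^ card \<gamma>) \<longlonglongrightarrow> inverse (zeta (UNIV :: ('a, 'd) config set) \<alpha>)"
    using convergent_prod_LIMSEQ[OF conv] by (simp add: prod_g)
  from tail show ?thesis
  proof eventually_elim
    case (elim k)
    let ?S = "small_orbits k :: ('a, 'd) config set set"
    define p where "p = small_orbit_prod TYPE(('a, 'd) config) \<alpha> k"
    have p: "0 \<le> p" "p \<le> 1"
      unfolding p_def small_orbit_prod_def using nonneg by (auto intro!: prod_nonneg prod_le_1)
    have "?S \<subseteq> e ` I" unfolding img by (auto simp: small_orbits_def)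
    then obtain I' where I': "I' \<subseteq> I" "finite I'" "?S = e ` I'"
      using finite_subset_image[OF finite_small_orbits] by metis
    have "\<forall>\<^sub>F M in sequentially. \<bar>(\<Prod>\<gamma>\<in>\<Gamma> M. 1 - \<alpha> ^ card \<gamma>) - p\<bar> \<le> \<epsilon> k"
      using eventually_ge_at_top[of "Max (insert 0 I')"]
    proof eventually_elim
      case (elim M)
      have "I' \<subseteq> {..M}" using elim I'(2) by (auto intro: order_trans[OF Max_ge])
      then have S\<Gamma>: "?S \<subseteq> \<Gamma> M" using I' by (auto simp: \<Gamma>_def)
      define r where "r = (\<Prod>\<gamma>\<in>\<Gamma> M - ?S. 1 - \<alpha> ^ card \<gamma>)"
      have split: "(\<Prod>\<gamma>\<in>\<Gamma> M. 1 - \<alpha> ^ card \<gamma>) = r * p"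
        unfolding r_def p_def small_orbit_prod_def by (rule prod.subset_diff[OF S\<Gamma> fin\<Gamma>])
      have "(\<Sum>\<gamma>\<in>\<Gamma> M - ?S. \<alpha> ^ card \<gamma>) \<le> \<epsilon> k"
        using \<Gamma>[of M] fin\<Gamma>[of M] \<open>\<forall>\<Gamma>. finite \<Gamma> \<longrightarrow> _\<close> by auto
      moreover have "1 - (\<Sum>\<gamma>\<in>\<Gamma> M - ?S. \<alpha> ^ card \<gamma>) \<le> r"
        unfolding r_def using fin\<Gamma> nonneg by (intro one_minus_sum_le_prod) auto
      ultimately have r: "1 - r \<le> \<epsilon> k" by linarith
      have r1: "r \<le> 1" unfolding r_def using nonneg by (intro prod_le_1) auto
      have "\<bar>r * p - p\<bar> = (1 - r) * p"
        using r1 p mult_right_mono[of r 1 p] by (simp add: left_diff_distrib)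
      also have "\<dots> \<le> (1 - r) * 1" using r1 p by (intro mult_left_mono) auto
      finally show ?case using r split by simp
    qed
    then have "\<bar>inverse (zeta (UNIV :: ('a, 'd) config set) \<alpha>) - p\<bar> \<le> \<epsilon> k"
      by (intro tendsto_upperbound[OF tendsto_rabs[OF tendsto_diff[OF lim tendsto_const]]]) auto
    then show ?case by (simp add: p_def)
  qed
qed

section \<open>Convergence and rates\<close>

lemma small_orbit_prod_le_exp:
  fixes \<alpha> :: real
  assumes "0 \<le> \<alpha>" "\<alpha> \<le> 1"
  shows "small_orbit_prod TYPE(('a::finite, 'd::finite) config) \<alpha> k
    \<le> exp (- (\<Sum>\<gamma>\<in>(small_orbits k :: ('a, 'd) config set set). \<alpha> ^ card \<gamma>))"
proof -
  have "small_orbit_prod TYPE(('a, 'd) config) \<alpha> k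
      \<le> (\<Prod>\<gamma>\<in>(small_orbits k :: ('a, 'd) config set set). exp (- (\<alpha> ^ card \<gamma>)))"
    unfolding small_orbit_prod_def
  proof (intro prod_mono conjI)
    fix \<gamma> :: "('a, 'd) config set"
    show "0 \<le> 1 - \<alpha> ^ card \<gamma>" using assms by (simp add: power_le_one)
    show "1 - \<alpha> ^ card \<gamma> \<le> exp (- (\<alpha> ^ card \<gamma>))" using exp_ge_add_one_self[of "- (\<alpha> ^ card \<gamma>)"] by simp
  qed
  then show ?thesis by (simp add: exp_sum finite_small_orbits flip: sum_negf)
qed

lemma small_orbits_sum_ge:
  fixes \<alpha> :: real
  assumes N: "2 \<le> CARD('a::finite)" and \<alpha>: "0 \<le> \<alpha>"
  shows "(\<Sum>j=4..k. (real CARD('a) * \<alpha>) ^ j / (2 * real j))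
    \<le> (\<Sum>\<gamma>\<in>(small_orbits k :: ('a, 'd::finite) config set set). \<alpha> ^ card \<gamma>)"
proof -
  have "(\<Sum>j=4..k. (real CARD('a) * \<alpha>) ^ j / (2 * real j))
      \<le> (\<Sum>j=4..k. \<Sum>\<gamma>\<in>(orbits_of_card j :: ('a, 'd) config set set). \<alpha> ^ card \<gamma>)"
  proof (rule sum_mono)
    fix j assume "j \<in> {4..k}"
    then have j: "4 \<le> j" by simp
    have "real (CARD('a) ^ j) \<le> real (2 * j * card (orbits_of_card j :: ('a, 'd) config set set))"
      using card_orbits_of_card_ge[OF N j] by (simp only: of_nat_le_iff)
    then have "real CARD('a) ^ j / (2 * real j) \<le> card (orbits_of_card j :: ('a, 'd) config set set)"
      using j by (simp add: divide_le_eq mult_ac)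
    then have "real CARD('a) ^ j / (2 * real j) * \<alpha> ^ j
        \<le> card (orbits_of_card j :: ('a, 'd) config set set) * \<alpha> ^ j"
      using \<alpha> by (intro mult_right_mono) auto
    also have "\<dots> = (\<Sum>\<gamma>\<in>(orbits_of_card j :: ('a, 'd) config set set). \<alpha> ^ card \<gamma>)"
      by (simp add: orbits_of_card_def)
    finally show "(real CARD('a) * \<alpha>) ^ j / (2 * real j)
        \<le> (\<Sum>\<gamma>\<in>(orbits_of_card j :: ('a, 'd) config set set). \<alpha> ^ card \<gamma>)"
      by (simp add: power_mult_distrib)
  qed
  also have "\<dots> = (\<Sum>\<gamma>\<in>(\<Union>j\<in>{4..k}. orbits_of_card j :: ('a, 'd) config set set). \<alpha> ^ card \<gamma>)"
    by (rule sum.UNION_disjoint[symmetric]) (auto simp: finite_orbits_of_card, auto simp: orbits_of_card_def)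
  also have "\<dots> \<le> (\<Sum>\<gamma>\<in>(small_orbits k :: ('a, 'd) config set set). \<alpha> ^ card \<gamma>)"
    using \<alpha> by (intro sum_mono2 finite_small_orbits) (auto simp: small_orbits_def orbits_of_card_def)
  finally show ?thesis .
qed

text \<open>A constant configuration is a fixed point and contributes the factor 0. This settles the
  one-letter alphabet, whose critical value is 1.\<close>

lemma small_orbit_prod_1:
  assumes "1 \<le> k"
  shows "small_orbit_prod TYPE(('a::finite, 'd::finite) config) 1 k = 0"
proof -
  define \<gamma> :: "('a, 'd) config set" where "\<gamma> = {\<lambda>_. undefined}"
  have "\<gamma> \<in> small_orbits k"
    using assms by (auto simp: \<gamma>_def small_orbits_def finite_orbits_def finite_orbit_def shift_def)
  then show ?thesis unfolding small_orbit_prod_def by (intro prod_zero finite_small_orbits) auto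
qed

text \<open>Orbits of size \<open>j\<close> contribute at least 1/(2j) to the exponent, so the
  harmonic series drives the product to 0. The constant 1 in the exponent pays for the sizes below
  4.\<close>

lemma small_orbit_prod_critical:
  fixes \<alpha> :: real
  assumes \<alpha>: "0 \<le> \<alpha>" "\<alpha> \<le> 1" "inverse (real CARD('a::finite)) \<le> \<alpha>" and N: "2 \<le> CARD('a)"
  shows "(\<lambda>k. small_orbit_prod TYPE(('a, 'd::finite) config) \<alpha> k) \<longlonglongrightarrow> 0"
proof (rule tendsto_sandwich)
  have r: "1 \<le> real CARD('a) * \<alpha>" using \<alpha>(3) N by (simp add: inverse_eq_divide divide_le_eq mult.commute)
  show "\<forall>\<^sub>F k in sequentially. 0 \<le> small_orbit_prod TYPE(('a, 'd) config) \<alpha> k"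
    unfolding small_orbit_prod_def using \<alpha> by (intro always_eventually allI prod_nonneg) (auto simp: power_le_one)
  show "\<forall>\<^sub>F k in sequentially. small_orbit_prod TYPE(('a, 'd) config) \<alpha> k \<le> exp (1 - ln (real k + 1) / 2)"
    using eventually_ge_at_top[of 4]
  proof eventually_elim
    case (elim k)
    have "ln (real k + 1) \<le> harm k" by (rule ln_le_harm)
    also have "harm k = (\<Sum>j\<in>{1..3} \<union> {4..k}. inverse (real j))"
      unfolding harm_def using elim by (intro sum.cong) auto
    also have "\<dots> = (\<Sum>j=1..3. inverse (real j)) + (\<Sum>j=4..k. inverse (real j))"
      by (rule sum.union_disjoint) auto
    also have "(\<Sum>j=1..3. inverse (real j)) \<le> 2" by (simp add: numeral_3_eq_3)
    finally have "ln (real k + 1) / 2 - 1 \<le> (\<Sum>j=4..k. inverse (real j)) / 2" by simp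
    also have "\<dots> = (\<Sum>j=4..k. inverse (real j) / 2)" by (rule sum_divide_distrib)
    also have "\<dots> \<le> (\<Sum>j=4..k. (real CARD('a) * \<alpha>) ^ j / (2 * real j))"
    proof (rule sum_mono)
      fix j
      have "1 / (2 * real j) \<le> (real CARD('a) * \<alpha>) ^ j / (2 * real j)"
        using one_le_power[OF r] by (rule divide_right_mono) simp
      then show "inverse (real j) / 2 \<le> (real CARD('a) * \<alpha>) ^ j / (2 * real j)"
        by (simp add: inverse_eq_divide)
    qed
    also have "\<dots> \<le> (\<Sum>\<gamma>\<in>(small_orbits k :: ('a, 'd) config set set). \<alpha> ^ card \<gamma>)"
      by (rule small_orbits_sum_ge[OF N \<alpha>(1)])
    finally have "exp (- (\<Sum>\<gamma>\<in>(small_orbits k :: ('a, 'd) config set set). \<alpha> ^ card \<gamma>))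
        \<le> exp (1 - ln (real k + 1) / 2)" by simp
    then show ?case using small_orbit_prod_le_exp[OF \<alpha>(1,2), of k, where 'a = 'a and 'd = 'd] by linarith
  qed
  show "(\<lambda>k. exp (1 - ln (real k + 1) / 2)) \<longlonglongrightarrow> 0" by real_asymp
qed auto

text \<open>The orbits of size \<open>k\<close> alone contribute r^k / (2k) with r > 1, which
  eventually exceeds \<open>k\<close>.\<close>

lemma small_orbit_prod_supercritical:
  fixes \<alpha> :: real
  assumes \<alpha>: "0 \<le> \<alpha>" "\<alpha> \<le> 1" "inverse (real CARD('a::finite)) < \<alpha>"
  shows "\<forall>\<^sub>F k in sequentially. small_orbit_prod TYPE(('a, 'd::finite) config) \<alpha> k \<le> exp (- real k)"
proof -
  define r where "r = real CARD('a) * \<alpha>"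
  have r: "1 < r" using \<alpha>(3) by (simp add: r_def inverse_eq_divide divide_less_eq mult.commute)
  have N: "2 \<le> CARD('a)"
  proof (rule ccontr)
    assume "\<not> ?thesis"
    moreover have "0 < CARD('a)" by simp
    ultimately have "CARD('a) = 1" by linarith
    then show False using \<alpha> by simp
  qed
  have "(\<lambda>k. 2 * real k ^ 2 / r ^ k) \<longlonglongrightarrow> 0" using r by real_asymp
  then have "\<forall>\<^sub>F k in sequentially. 2 * real k ^ 2 / r ^ k < 1" by (rule order_tendstoD) simp
  then show ?thesis
    using eventually_ge_at_top[of 4]
  proof eventually_elim
    case (elim k)
    have "2 * real k ^ 2 \<le> r ^ k" using elim r by (simp add: divide_less_eq)
    then have "real k \<le> r ^ k / (2 * real k)" using elim by (simp add: field_simps power2_eq_square)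
    also have "\<dots> \<le> (\<Sum>j=4..k. r ^ j / (2 * real j))"
      using r elim by (intro member_le_sum) auto
    also have "\<dots> \<le> (\<Sum>\<gamma>\<in>(small_orbits k :: ('a, 'd) config set set). \<alpha> ^ card \<gamma>)"
      unfolding r_def by (rule small_orbits_sum_ge[OF N \<alpha>(1)])
    finally have "exp (- (\<Sum>\<gamma>\<in>(small_orbits k :: ('a, 'd) config set set). \<alpha> ^ card \<gamma>)) \<le> exp (- real k)"
      by simp
    then show ?case using small_orbit_prod_le_exp[OF \<alpha>(1,2), of k, where 'a = 'a and 'd = 'd] by linarith
  qed
qed

lemma filterlim_div_2: "filterlim (\<lambda>n::nat. n div 2) sequentially sequentially"
proof (rule filterlim_at_top[THEN iffD2], intro allI)
  fix Z :: nat
  show "\<forall>\<^sub>F n in sequentially. Z \<le> n div 2"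
    using eventually_ge_at_top[of "2 * Z"] by eventually_elim linarith
qed

lemma exponential_rate_half:
  fixes P :: "nat \<Rightarrow> real"
  assumes \<theta>: "0 < \<theta>" "\<theta> < 1" and C: "0 < C"
    and bound: "\<forall>\<^sub>F n in sequentially. \<bar>P n - L\<bar> \<le> C * \<theta> ^ (n div 2)"
  shows "P \<longlonglongrightarrow> L \<and>
    (\<exists>C \<beta> n0. 0 < C \<and> 0 < \<beta> \<and> \<beta> < 1 \<and> (\<forall>n\<ge>n0. \<bar>P n - L\<bar> \<le> C * \<beta> ^ n))"
proof -
  \<comment> \<open>The square root undoes the halving of the exponent, and the factor 1/\<beta>
    absorbs the loss for odd \<open>n\<close>.\<close>
  define \<beta> where "\<beta> = sqrt \<theta>"
  have \<beta>: "0 < \<beta>" "\<beta> < 1" "\<theta> = \<beta> ^ 2" using \<theta> by (auto simp: \<beta>_def)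
  have half: "\<theta> ^ (n div 2) \<le> \<beta> ^ n / \<beta>" for n
  proof -
    have "\<theta> ^ (n div 2) * \<beta> = \<beta> ^ Suc (2 * (n div 2))" by (simp add: \<beta>(3) power_mult)
    also have "\<dots> \<le> \<beta> ^ n" using \<beta> by (intro power_decreasing) auto
    finally show ?thesis using \<beta> by (simp add: le_divide_eq)
  qed
  have ev: "\<forall>\<^sub>F n in sequentially. \<bar>P n - L\<bar> \<le> C / \<beta> * \<beta> ^ n"
    using bound
  proof eventually_elim
    case (elim n)
    also have "C * \<theta> ^ (n div 2) \<le> C * (\<beta> ^ n / \<beta>)" using half C by (intro mult_left_mono) auto
    finally show ?case by simp
  qed
  have "(\<lambda>n. C / \<beta> * \<beta> ^ n) \<longlonglongrightarrow> C / \<beta> * 0"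
    using \<beta> by (intro tendsto_mult tendsto_const LIMSEQ_power_zero) simp
  then have "(\<lambda>n. C / \<beta> * \<beta> ^ n) \<longlonglongrightarrow> 0" by (simp only: mult_zero_right)
  with ev have "(\<lambda>n. P n - L) \<longlonglongrightarrow> 0"
    unfolding real_norm_def[symmetric] by (rule Lim_null_comparison)
  then have "P \<longlonglongrightarrow> L" by (rule LIM_zero_cancel)
  moreover obtain n0 where "\<forall>n\<ge>n0. \<bar>P n - L\<bar> \<le> C / \<beta> * \<beta> ^ n"
    using ev unfolding eventually_sequentially by blast
  then have "\<exists>C \<beta> n0. 0 < C \<and> 0 < \<beta> \<and> \<beta> < 1 \<and> (\<forall>n\<ge>n0. \<bar>P n - L\<bar> \<le> C * \<beta> ^ n)"
    using \<beta> C by (intro exI[of _ "C / \<beta>"] exI[of _ \<beta>] exI[of _ n0]) auto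
  ultimately show ?thesis by blast
qed

theorem theorem1p1:
  fixes \<alpha> :: real
    and P :: "nat \<Rightarrow> real"
    and L :: real
  assumes \<alpha>: "0 \<le> \<alpha>" "\<alpha> \<le> 1"
    and P: "\<And>n. P n = measure_pmf.prob (random_patterns n \<alpha>)
                        (emptiness_event n :: ('a::finite, 'd::finite) config set set)"
    and L: "L = (if \<alpha> < inverse (real CARD('a))
                 then inverse (zeta (UNIV :: ('a, 'd) config set) \<alpha>) else 0)"
  shows "P \<longlonglongrightarrow> L \<and>
    (\<alpha> \<noteq> inverse (real CARD('a)) \<longrightarrow>
      (\<exists>C \<beta> n0. 0 < C \<and> 0 < \<beta> \<and> \<beta> < 1 \<and> (\<forall>n\<ge>n0. \<bar>P n - L\<bar> \<le> C * \<beta> ^ n)))"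
proof -
  let ?s = "\<lambda>k. small_orbit_prod TYPE(('a, 'd) config) \<alpha> k"
  have P_le: "P n \<le> ?s (n div 2)" and P_nonneg: "0 \<le> P n" for n
    unfolding P using prob_empty_le_small_orbit_prod[OF \<alpha>] by auto
  consider "\<alpha> < inverse (real CARD('a))" | "\<alpha> = inverse (real CARD('a))" | "inverse (real CARD('a)) < \<alpha>"
    by linarith
  then show ?thesis
  proof cases
    case 1
    obtain \<theta> where \<theta>: "0 < \<theta>" "\<theta> < 1"
      and A: "\<forall>\<^sub>F n in sequentially. \<bar>P n - ?s (n div 2)\<bar> \<le> \<theta> ^ (n div 2) / (1 - \<theta>)"
      and B: "\<forall>\<^sub>F k in sequentially. \<forall>\<Gamma>. finite \<Gamma> \<longrightarrow>
        \<Gamma> \<subseteq> finite_orbits (UNIV :: ('a, 'd) config set) - small_orbits k \<longrightarrow>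
        (\<Sum>\<gamma>\<in>\<Gamma>. \<alpha> ^ card \<gamma>) \<le> \<theta> ^ k / (1 - \<theta>)"
      using subcritical_bounds[OF \<alpha>(1) 1, where 'd = 'd] unfolding P by blast
    have "inverse (real CARD('a)) \<le> 1" by (simp add: inverse_le_1_iff Suc_le_eq)
    then have "\<alpha> < 1" using 1 by linarith
    from zeta_tail[OF \<alpha>(1) this B]
    have "\<forall>\<^sub>F k in sequentially. \<bar>L - ?s k\<bar> \<le> \<theta> ^ k / (1 - \<theta>)" using 1 by (simp add: L)
    then have "\<forall>\<^sub>F n in sequentially. \<bar>L - ?s (n div 2)\<bar> \<le> \<theta> ^ (n div 2) / (1 - \<theta>)"
      by (rule eventually_compose_filterlim[OF _ filterlim_div_2])
    with A have "\<forall>\<^sub>F n in sequentially. \<bar>P n - L\<bar> \<le> 2 / (1 - \<theta>) * \<theta> ^ (n div 2)"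
    proof eventually_elim
      case (elim n)
      have "2 / (1 - \<theta>) * \<theta> ^ (n div 2) = \<theta> ^ (n div 2) / (1 - \<theta>) + \<theta> ^ (n div 2) / (1 - \<theta>)"
        by simp
      with elim show ?case by linarith
    qed
    from exponential_rate_half[OF \<theta> _ this] show ?thesis using \<theta> by simp
  next
    case 2
    have "?s \<longlonglongrightarrow> 0"
    proof (cases "2 \<le> CARD('a)")
      case True
      then show ?thesis using 2 \<alpha> by (intro small_orbit_prod_critical) auto
    next
      case False
      moreover have "0 < CARD('a)" by simp
      ultimately have "CARD('a) = 1" by linarith
      then have "\<alpha> = 1" using 2 by simp
      then have "\<forall>\<^sub>F k in sequentially. ?s k = 0"
        by (intro eventually_sequentiallyI[of 1]) (simp add: small_orbit_prod_1)
      then show ?thesis by (rule tendsto_eventually)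
    qed
    then have "(\<lambda>n. ?s (n div 2)) \<longlonglongrightarrow> 0" by (rule filterlim_compose[OF _ filterlim_div_2])
    then have "P \<longlonglongrightarrow> 0"
      using P_le P_nonneg by (intro tendsto_sandwich[of "\<lambda>_. 0" P]) auto
    then show ?thesis using 2 by (simp add: L)
  next
    case 3
    have "\<forall>\<^sub>F n in sequentially. ?s (n div 2) \<le> exp (- real (n div 2))"
      by (rule eventually_compose_filterlim[OF small_orbit_prod_supercritical[OF \<alpha> 3] filterlim_div_2])
    then have "\<forall>\<^sub>F n in sequentially. \<bar>P n - L\<bar> \<le> 1 * exp (- 1) ^ (n div 2)"
    proof eventually_elim
      case (elim n)
      then show ?case
        using P_le[of n] P_nonneg[of n] 3 by (simp add: L exp_of_nat_mult[symmetric])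
    qed
    from exponential_rate_half[OF _ _ _ this] show ?thesis by simp
  qed
qed

end
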